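(* Let $k$ be a field of characteristic zero, let $p,q,r\ge 2$ be integers, and let $A=k[x,y,z]/(x^p+y^q+z^r-1)$, $\Omega=\Omega^1_{A/k}$. Let $\nabla:\operatorname{Der}_k(A)\to\operatorname{End}_k(\Omega)$ be the connection for which $\nabla(\delta)$ is induced by $D_\delta+\delta(M):A^3\to A^3$. Then $\operatorname{tr}(R_\nabla)=0$, i.e. $\operatorname{tr}(R_\nabla(\delta\wedge\eta))=0$ in $A$ for all $\delta,\eta\in\operatorname{Der}_k(A)$.
   Context: $\Omega$ is a projective $A$-module of rank two. Identify $\Omega=A\{u_1,u_2,u_3\}/A\,dF$, where $dF=px^{p-1}u_1+qy^{q-1}u_2+rz^{r-1}u_3$ and $u_1,u_2,u_3$ (a free basis of $A^3$) map to $dx,dy,dz$. Let $$M=\begin{pmatrix}1-x^p&-\frac pq x^{p-1}y&-\frac pr x^{p-1}z\\ -\frac qp xy^{q-1}&1-y^q&-\frac qr y^{q-1}z\\ -\frac rp xz^{r-1}&-\frac rq yz^{r-1}&1-z^r\end{pmatrix},$$ acting on $A^3$ (column vectors in the basis $u_1,u_2,u_3$). For $\delta\in\operatorname{Der}_k(A)$ let $D_\delta(\sum a_iu_i)=\sum\delta(a_i)u_i$ and let $\delta(M)$ be the matrix obtained by applying $\delta$ to the entries of $M$. The operator $D_\delta+\delta(M)$ maps $A\,dF$ into itself and so induces an operator $\nabla(\delta)$ on $\Omega$; $\nabla$ is a connection. Its curvature $R_\nabla(\delta\wedge\eta)=[\nabla(\delta),\nabla(\eta)]-\nabla([\delta,\eta])$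 lies in $\operatorname{End}_A(\Omega)$. The trace of an endomorphism of a finitely generated projective module $E$ is defined via $E^*\otimes_AE\cong\operatorname{End}_A(E)$ and $g\otimes e\mapsto g(e)$. *)

theory Defs
  imports "HOL-Algebra.Algebra" "HOL-Algebra.Algebraic_Closure_Type" "HOL-Library.Poly_Mapping"
begin

section \<open>Derivations, free modules, quotient modules, trace\<close>

text \<open>
  Functions on a carrier (derivations, linear forms, endomorphisms) are total HOL functions
  constrained only on the carrier, as for \<^const>\<open>hom\<close>.
\<close>

definition derivations ::
    "('k \<Rightarrow> 'a) \<Rightarrow> ('a, 'm) ring_scheme \<Rightarrow> ('a \<Rightarrow> 'a) set"
    \<comment> \<open>\<open>derivations \<iota> B\<close> is \<open>Der\<^sub>k(B)\<close>, the ring \<open>B\<close> being a \<open>k\<close>-algebra via \<open>\<iota>\<close>\<close>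
  where "derivations \<iota> B =
    {\<delta> \<in> carrier B \<rightarrow> carrier B.
       (\<forall>a\<in>carrier B. \<forall>b\<in>carrier B. \<delta> (a \<oplus>\<^bsub>B\<^esub> b) = \<delta> a \<oplus>\<^bsub>B\<^esub> \<delta> b) \<and>
       (\<forall>c. \<forall>a\<in>carrier B. \<delta> (\<iota> c \<otimes>\<^bsub>B\<^esub> a) = \<iota> c \<otimes>\<^bsub>B\<^esub> \<delta> a) \<and>
       (\<forall>a\<in>carrier B. \<forall>b\<in>carrier B.
          \<delta> (a \<otimes>\<^bsub>B\<^esub> b) = (\<delta> a \<otimes>\<^bsub>B\<^esub> b) \<oplus>\<^bsub>B\<^esub> (a \<otimes>\<^bsub>B\<^esub> \<delta> b))}"

definition der_bracket :: "('a, 'm) ring_scheme \<Rightarrow> ('a \<Rightarrow> 'a) \<Rightarrow> ('a \<Rightarrow> 'a) \<Rightarrow> 'a \<Rightarrow> 'a"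
  where "der_bracket B \<delta> \<eta> = (\<lambda>a. \<delta> (\<eta> a) \<ominus>\<^bsub>B\<^esub> \<eta> (\<delta> a))"

definition free_module :: "('a, 'm) ring_scheme \<Rightarrow> ('a, 'i \<Rightarrow> 'a) module"
    \<comment> \<open>Meant for a finite index type \<open>'i\<close>. The ring fields \<open>monoid.mult\<close> and \<open>one\<close>
      of a \<^typ>\<open>('a, 'b) module\<close> record have no meaning here or below.\<close>
  where "free_module B =
    \<lparr>carrier = UNIV \<rightarrow> carrier B, monoid.mult = undefined, monoid.one = undefined,
     ring.zero = (\<lambda>i. \<zero>\<^bsub>B\<^esub>), ring.add = (\<lambda>v w i. v i \<oplus>\<^bsub>B\<^esub> w i),
     module.smult = (\<lambda>a v i. a \<otimes>\<^bsub>B\<^esub> v i)\<rparr>"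

definition quot_module :: "('a, 'b) module \<Rightarrow> 'b set \<Rightarrow> ('a, 'b set) module"
  where "quot_module E N =
    \<lparr>carrier = a_rcosets\<^bsub>E\<^esub> N, monoid.mult = undefined, monoid.one = undefined,
     ring.zero = N, ring.add = set_add E,
     module.smult = (\<lambda>a C. \<Union>v\<in>C. N +>\<^bsub>E\<^esub> (a \<odot>\<^bsub>E\<^esub> v))\<rparr>"

definition induced_on_quot :: "('a, 'b) module \<Rightarrow> 'b set \<Rightarrow> ('b \<Rightarrow> 'b) \<Rightarrow> 'b set \<Rightarrow> 'b set"
    \<comment> \<open>\<open>v + N \<mapsto> T v + N\<close>; the union is this one coset if \<open>T\<close> is additive and maps \<open>N\<close> into itself\<close>
  where "induced_on_quot E N T = (\<lambda>C. \<Union>v\<in>C. N +>\<^bsub>E\<^esub> T v)"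

definition dual_module :: "('a, 'm) ring_scheme \<Rightarrow> ('a, 'b) module \<Rightarrow> ('b \<Rightarrow> 'a) set"
  where "dual_module B E =
    {g \<in> carrier E \<rightarrow> carrier B.
       (\<forall>u\<in>carrier E. \<forall>v\<in>carrier E. g (u \<oplus>\<^bsub>E\<^esub> v) = g u \<oplus>\<^bsub>B\<^esub> g v) \<and>
       (\<forall>a\<in>carrier B. \<forall>v\<in>carrier E. g (a \<odot>\<^bsub>E\<^esub> v) = a \<otimes>\<^bsub>B\<^esub> g v)}"

text \<open>
  Every element of \<open>E\<^sup>* \<otimes> E\<close> is a finite sum \<open>\<Sum> g\<^sub>i \<otimes> e\<^sub>i\<close>. It is sent to the endomorphism
  \<open>m \<mapsto> \<Sum> g\<^sub>i(m) e\<^sub>i\<close> by the canonical map to \<open>End(E)\<close>, and to \<open>\<Sum> g\<^sub>i(e\<^sub>i)\<close> by evaluation.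
  \<open>trace_values B E \<phi>\<close> is the set of evaluations of all preimages of \<open>\<phi>\<close>. It is a singleton when \<open>E\<close>
  is finitely generated projective and \<open>\<phi>\<close> is linear, the canonical map then being bijective.
\<close>

definition trace_values ::
    "('a, 'm) ring_scheme \<Rightarrow> ('a, 'b) module \<Rightarrow> ('b \<Rightarrow> 'b) \<Rightarrow> 'a set"
  where "trace_values B E \<phi> =
    {a. \<exists>(n::nat) g e.
          g \<in> {..<n} \<rightarrow> dual_module B E \<and> e \<in> {..<n} \<rightarrow> carrier E \<and>
          (\<forall>m\<in>carrier E. \<phi> m = (\<Oplus>\<^bsub>E\<^esub>i\<in>{..<n}. g i m \<odot>\<^bsub>E\<^esub> e i)) \<and>
          a = (\<Oplus>\<^bsub>B\<^esub>i\<in>{..<n}. g i (e i))}"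

definition module_trace ::
    "('a, 'm) ring_scheme \<Rightarrow> ('a, 'b) module \<Rightarrow> ('b \<Rightarrow> 'b) \<Rightarrow> 'a"
  where "module_trace B E \<phi> = (THE a. a \<in> trace_values B E \<phi>)"


section \<open>The algebra \<open>A = k[x,y,z]/(x\<^sup>p + y\<^sup>q + z\<^sup>r - 1)\<close>\<close>

datatype coord = Cx | Cy | Cz

type_synonym 'k poly3 = "(coord \<Rightarrow>\<^sub>0 nat) \<Rightarrow>\<^sub>0 'k"

definition Const :: "'k::comm_ring_1 \<Rightarrow> 'k poly3"
  where "Const c = Poly_Mapping.single 0 c"

definition Var :: "coord \<Rightarrow> 'k::comm_ring_1 poly3"
  where "Var i = Poly_Mapping.single (Poly_Mapping.single i 1) 1"

definition F_poly :: "nat \<Rightarrow> nat \<Rightarrow> nat \<Rightarrow> 'k::comm_ring_1 poly3"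
  where "F_poly p q r = Var Cx ^ p + Var Cy ^ q + Var Cz ^ r - 1"

abbreviation poly3_ring :: "'k::comm_ring_1 poly3 ring"
  where "poly3_ring \<equiv> ring_of_type_algebra"

definition F_ideal :: "nat \<Rightarrow> nat \<Rightarrow> nat \<Rightarrow> 'k::comm_ring_1 poly3 set"
  where "F_ideal p q r = Idl\<^bsub>poly3_ring\<^esub> {F_poly p q r}"

definition A_ring :: "nat \<Rightarrow> nat \<Rightarrow> nat \<Rightarrow> 'k::comm_ring_1 poly3 set ring"
  where "A_ring p q r = poly3_ring Quot F_ideal p q r"

definition residue :: "nat \<Rightarrow> nat \<Rightarrow> nat \<Rightarrow> 'k::comm_ring_1 poly3 \<Rightarrow> 'k poly3 set"
  where "residue p q r f = F_ideal p q r +>\<^bsub>poly3_ring\<^esub> f"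

definition Der_A ::
    "nat \<Rightarrow> nat \<Rightarrow> nat \<Rightarrow> ('k::comm_ring_1 poly3 set \<Rightarrow> 'k poly3 set) set"
  where "Der_A p q r = derivations (\<lambda>c. residue p q r (Const c)) (A_ring p q r)"


section \<open>The module \<open>\<Omega>\<close> and the connection\<close>

abbreviation A3 :: "nat \<Rightarrow> nat \<Rightarrow> nat \<Rightarrow>
    ('k::comm_ring_1 poly3 set, coord \<Rightarrow> 'k poly3 set) module"
  where "A3 p q r \<equiv> free_module (A_ring p q r)"

fun dF_poly :: "nat \<Rightarrow> nat \<Rightarrow> nat \<Rightarrow> coord \<Rightarrow> 'k::comm_ring_1 poly3"
  where
    "dF_poly p q r Cx = of_nat p * Var Cx ^ (p - 1)"
  | "dF_poly p q r Cy = of_nat q * Var Cy ^ (q - 1)"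
  | "dF_poly p q r Cz = of_nat r * Var Cz ^ (r - 1)"

definition dF :: "nat \<Rightarrow> nat \<Rightarrow> nat \<Rightarrow> coord \<Rightarrow> 'k::comm_ring_1 poly3 set"
  where "dF p q r = (\<lambda>i. residue p q r (dF_poly p q r i))"

definition A_dF :: "nat \<Rightarrow> nat \<Rightarrow> nat \<Rightarrow> (coord \<Rightarrow> 'k::comm_ring_1 poly3 set) set"
  where "A_dF p q r = {a \<odot>\<^bsub>A3 p q r\<^esub> dF p q r | a. a \<in> carrier (A_ring p q r)}"

text \<open>
  The Kaehler differentials in the presentation \<open>\<Omega> = A{u\<^sub>1,u\<^sub>2,u\<^sub>3}/A dF\<close>, where the classes of
  \<open>u\<^sub>1, u\<^sub>2, u\<^sub>3\<close> are \<open>dx, dy, dz\<close>.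
\<close>

definition Omega :: "nat \<Rightarrow> nat \<Rightarrow> nat \<Rightarrow>
    ('k::comm_ring_1 poly3 set, (coord \<Rightarrow> 'k poly3 set) set) module"
  where "Omega p q r = quot_module (A3 p q r) (A_dF p q r)"

fun M_poly :: "nat \<Rightarrow> nat \<Rightarrow> nat \<Rightarrow> coord \<Rightarrow> coord \<Rightarrow> 'k::field_char_0 poly3"
    \<comment> \<open>row index first\<close>
  where
    "M_poly p q r Cx Cx = 1 - Var Cx ^ p"
  | "M_poly p q r Cx Cy = - (Const (of_nat p / of_nat q) * Var Cx ^ (p - 1) * Var Cy)"
  | "M_poly p q r Cx Cz = - (Const (of_nat p / of_nat r) * Var Cx ^ (p - 1) * Var Cz)"
  | "M_poly p q r Cy Cx = - (Const (of_nat q / of_nat p) * Var Cx * Var Cy ^ (q - 1))"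
  | "M_poly p q r Cy Cy = 1 - Var Cy ^ q"
  | "M_poly p q r Cy Cz = - (Const (of_nat q / of_nat r) * Var Cy ^ (q - 1) * Var Cz)"
  | "M_poly p q r Cz Cx = - (Const (of_nat r / of_nat p) * Var Cx * Var Cz ^ (r - 1))"
  | "M_poly p q r Cz Cy = - (Const (of_nat r / of_nat q) * Var Cy * Var Cz ^ (r - 1))"
  | "M_poly p q r Cz Cz = 1 - Var Cz ^ r"

definition M_mat :: "nat \<Rightarrow> nat \<Rightarrow> nat \<Rightarrow> coord \<Rightarrow> coord \<Rightarrow> 'k::field_char_0 poly3 set"
  where "M_mat p q r = (\<lambda>i j. residue p q r (M_poly p q r i j))"

definition lifted_op :: "nat \<Rightarrow> nat \<Rightarrow> nat \<Rightarrow>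
    ('k::field_char_0 poly3 set \<Rightarrow> 'k poly3 set) \<Rightarrow>
    (coord \<Rightarrow> 'k poly3 set) \<Rightarrow> (coord \<Rightarrow> 'k poly3 set)"
    \<comment> \<open>\<open>D\<^sub>\<delta> + \<delta>(M)\<close> on \<open>A\<^sup>3\<close>\<close>
  where "lifted_op p q r \<delta> v =
    (\<lambda>i. \<delta> (v i)) \<oplus>\<^bsub>A3 p q r\<^esub>
    (\<lambda>i. \<Oplus>\<^bsub>A_ring p q r\<^esub>j\<in>UNIV. \<delta> (M_mat p q r i j) \<otimes>\<^bsub>A_ring p q r\<^esub> v j)"

definition nabla :: "nat \<Rightarrow> nat \<Rightarrow> nat \<Rightarrow>
    ('k::field_char_0 poly3 set \<Rightarrow> 'k poly3 set) \<Rightarrow>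
    (coord \<Rightarrow> 'k poly3 set) set \<Rightarrow> (coord \<Rightarrow> 'k poly3 set) set"
  where "nabla p q r \<delta> = induced_on_quot (A3 p q r) (A_dF p q r) (lifted_op p q r \<delta>)"

definition curvature :: "nat \<Rightarrow> nat \<Rightarrow> nat \<Rightarrow>
    ('k::field_char_0 poly3 set \<Rightarrow> 'k poly3 set) \<Rightarrow> ('k poly3 set \<Rightarrow> 'k poly3 set) \<Rightarrow>
    (coord \<Rightarrow> 'k poly3 set) set \<Rightarrow> (coord \<Rightarrow> 'k poly3 set) set"
  where "curvature p q r \<delta> \<eta> = (\<lambda>\<omega>.
    (nabla p q r \<delta> (nabla p q r \<eta> \<omega>) \<ominus>\<^bsub>Omega p q r\<^esub> nabla p q r \<eta> (nabla p q r \<delta> \<omega>))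
      \<ominus>\<^bsub>Omega p q r\<^esub> nabla p q r (der_bracket (A_ring p q r) \<delta> \<eta>) \<omega>)"

end

theory Submission
  imports Defs
begin

text \<open>
  Write \<open>f\<close> for the column vector \<open>dF\<close> and \<open>e\<close> for the row vector \<open>(x/p, y/q, z/r)\<close>. In \<open>A\<close> the
  Euler relation reads \<open>\<langle>e,f\<rangle> = x\<^sup>p + y\<^sup>q + z\<^sup>r = 1\<close>, and \<open>M = 1 - f e\<close> is the projection of \<open>A\<^sup>3\<close>
  along the line \<open>A f\<close>. Its rows and the classes of the unit vectors form a dual basis of
  \<open>\<Omega> = A\<^sup>3/A f\<close> (\<open>cls_dual_basis\<close>), so an endomorphism of \<open>\<Omega>\<close> has a well-defined trace, which may
  be computed from any presentation as \<open>\<Sum> g\<^sub>i \<otimes> e\<^sub>i\<close> (\<open>module_trace_eqI\<close>).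

  Modulo \<open>A f\<close> one has \<open>\<delta>(M) v = - \<langle>e,v\<rangle> \<delta>(f)\<close>, hence \<open>\<nabla>(\<delta>)\<close> is induced by
  \<open>v \<mapsto> \<delta>(v) - \<langle>e,v\<rangle> \<delta>(f)\<close>. A direct computation with this short form (\<open>curv_cls\<close>) gives the curvature
  as \<open>\<lambda>\<^sub>\<eta> \<otimes> \<delta>(f) - \<lambda>\<^sub>\<delta> \<otimes> \<eta>(f)\<close>, where \<open>\<lambda>\<^sub>\<delta> = \<delta>(e) + \<langle>e,\<delta>(f)\<rangle> e\<close> vanishes on \<open>f\<close> because
  \<open>\<delta>\<langle>e,f\<rangle> = 0\<close>. Evaluating, the trace is \<open>\<langle>\<eta>(e),\<delta>(f)\<rangle> - \<langle>\<delta>(e),\<eta>(f)\<rangle>\<close> (\<open>module_trace_curv\<close>).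
  All this holds for any vector \<open>f\<close> over a commutative ring that has such an \<open>e\<close>.

  For the given \<open>f\<close> and \<open>e\<close> the trace vanishes since the variables are separated: in the \<open>x\<close>-coordinate,
  for instance, \<open>\<eta>(x/p) \<delta>(p x\<^sup>p\<^sup>-\<^sup>1) = (p-1) x\<^sup>p\<^sup>-\<^sup>2 \<delta>(x) \<eta>(x)\<close> is symmetric in \<open>\<delta>\<close> and \<open>\<eta>\<close>
  (\<open>der_euler_dF_symmetric\<close>).
\<close>

section \<open>The trace and dual bases\<close>

lemma (in abelian_monoid) finsum_swap:
  assumes "finite I" "finite J" "\<And>i j. i \<in> I \<Longrightarrow> j \<in> J \<Longrightarrow> c i j \<in> carrier G"
  shows "(\<Oplus>i\<in>I. \<Oplus>j\<in>J. c i j) = (\<Oplus>j\<in>J. \<Oplus>i\<in>I. c i j)"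
  using assms(1,3)
proof (induction I rule: finite_induct)
  case empty
  then show ?case by (simp add: finsum_zero)
next
  case (insert k I)
  have "(\<Oplus>i\<in>insert k I. \<Oplus>j\<in>J. c i j) = (\<Oplus>j\<in>J. c k j) \<oplus> (\<Oplus>j\<in>J. \<Oplus>i\<in>I. c i j)"
    using insert by (subst finsum_insert) (auto intro!: finsum_closed)
  also have "\<dots> = (\<Oplus>j\<in>J. c k j \<oplus> (\<Oplus>i\<in>I. c i j))"
    using insert.prems by (intro finsum_addf[symmetric]) (auto intro!: finsum_closed)
  also have "\<dots> = (\<Oplus>j\<in>J. \<Oplus>i\<in>insert k I. c i j)"
    using insert by (intro finsum_cong') (auto intro!: finsum_closed)
  finally show ?case .
qed

text \<open>
  The definitions of dual module, trace and quotient module are about \<^typ>\<open>('a, 'b) module\<close>, whereas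
  \<^locale>\<open>module\<close> allows records with further fields.
\<close>

locale module_record = module R M
  for R (structure) and M :: "('a, 'b) module" (structure)

lemma (in module_record) dual_module_zero:
  assumes "g \<in> dual_module R M"
  shows "g \<zero>\<^bsub>M\<^esub> = \<zero>"
proof -
  have "g (\<zero> \<odot>\<^bsub>M\<^esub> \<zero>\<^bsub>M\<^esub>) = \<zero> \<otimes> g \<zero>\<^bsub>M\<^esub>"
    using assms unfolding dual_module_def by blast
  moreover have "g \<zero>\<^bsub>M\<^esub> \<in> carrier R" using assms by (auto simp: dual_module_def)
  ultimately show ?thesis by (metis M.zero_closed R.l_null smult_l_null)
qed

lemma (in module_record) dual_module_finsum:
  assumes g: "g \<in> dual_module R M" and "finite I"
    and "\<And>i. i \<in> I \<Longrightarrow> c i \<in> carrier R" "\<And>i. i \<in> I \<Longrightarrow> w i \<in> carrier M"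
  shows "g (\<Oplus>\<^bsub>M\<^esub>i\<in>I. c i \<odot>\<^bsub>M\<^esub> w i) = (\<Oplus>i\<in>I. c i \<otimes> g (w i))"
  using assms(2-4)
proof (induction I rule: finite_induct)
  case empty
  then show ?case by (simp add: dual_module_zero[OF g])
next
  case (insert k I)
  then have cl: "(\<lambda>i. c i \<odot>\<^bsub>M\<^esub> w i) \<in> I \<rightarrow> carrier M" "(\<lambda>i. c i \<otimes> g (w i)) \<in> I \<rightarrow> carrier R"
    "c k \<odot>\<^bsub>M\<^esub> w k \<in> carrier M" "c k \<otimes> g (w k) \<in> carrier R"
    using g unfolding dual_module_def by (auto simp: Pi_iff)
  then have s: "(\<Oplus>\<^bsub>M\<^esub>i\<in>I. c i \<odot>\<^bsub>M\<^esub> w i) \<in> carrier M"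
    by (intro M.finsum_closed)
  have "g (\<Oplus>\<^bsub>M\<^esub>i\<in>insert k I. c i \<odot>\<^bsub>M\<^esub> w i) =
      g (c k \<odot>\<^bsub>M\<^esub> w k \<oplus>\<^bsub>M\<^esub> (\<Oplus>\<^bsub>M\<^esub>i\<in>I. c i \<odot>\<^bsub>M\<^esub> w i))"
    using insert cl by (subst M.finsum_insert) auto
  also have "\<dots> = c k \<otimes> g (w k) \<oplus> (\<Oplus>i\<in>I. c i \<otimes> g (w i))"
    using g s insert cl unfolding dual_module_def by simp
  also have "\<dots> = (\<Oplus>i\<in>insert k I. c i \<otimes> g (w i))"
    using insert cl by (subst R.finsum_insert) auto
  finally show ?case .
qed

text \<open>
  A module with a dual basis \<open>(h\<^sub>j, w\<^sub>j)\<close> has at most one candidate for the trace. If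
  \<open>\<phi> = \<Sum> g\<^sub>i(_) e\<^sub>i\<close>, expand each \<open>e\<^sub>i\<close> in the dual basis: then
  \<open>\<Sum> g\<^sub>i(e\<^sub>i) = \<Sum> h\<^sub>j(e\<^sub>i) g\<^sub>i(w\<^sub>j) = \<Sum> h\<^sub>j(\<phi>(w\<^sub>j))\<close>, and the last sum no longer
  mentions the chosen representation of \<open>\<phi>\<close>.
\<close>

lemma (in module_record) trace_value_dual_basis:
  assumes "finite J"
    and h: "\<And>j. j \<in> J \<Longrightarrow> h j \<in> dual_module R M"
    and w: "\<And>j. j \<in> J \<Longrightarrow> w j \<in> carrier M"
    and basis: "\<And>m. m \<in> carrier M \<Longrightarrow> m = (\<Oplus>\<^bsub>M\<^esub>j\<in>J. h j m \<odot>\<^bsub>M\<^esub> w j)"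
    and a: "a \<in> trace_values R M \<phi>"
  shows "a = (\<Oplus>j\<in>J. h j (\<phi> (w j)))"
proof -
  obtain n :: nat and g e where "g \<in> {..<n} \<rightarrow> dual_module R M" "e \<in> {..<n} \<rightarrow> carrier M"
    "\<forall>m\<in>carrier M. \<phi> m = (\<Oplus>\<^bsub>M\<^esub>i\<in>{..<n}. g i m \<odot>\<^bsub>M\<^esub> e i)" and
    a_eq: "a = (\<Oplus>i\<in>{..<n}. g i (e i))"
    using a unfolding trace_values_def by blast
  then have
    g: "\<And>i. i < n \<Longrightarrow> g i \<in> dual_module R M" and
    e: "\<And>i. i < n \<Longrightarrow> e i \<in> carrier M" and
    \<phi>: "\<And>m. m \<in> carrier M \<Longrightarrow> \<phi> m = (\<Oplus>\<^bsub>M\<^esub>i\<in>{..<n}. g i m \<odot>\<^bsub>M\<^esub> e i)"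
    by auto
  have gcl: "g i m \<in> carrier R" if "i < n" "m \<in> carrier M" for i m
    using g[OF that(1)] that(2) by (auto simp: dual_module_def)
  have hcl: "h j m \<in> carrier R" if "j \<in> J" "m \<in> carrier M" for j m
    using h[OF that(1)] that(2) by (auto simp: dual_module_def)
  have "a = (\<Oplus>i\<in>{..<n}. \<Oplus>j\<in>J. h j (e i) \<otimes> g i (w j))"
    unfolding a_eq
  proof (intro R.finsum_cong' refl)
    fix i assume "i \<in> {..<n}"
    then have i: "i < n" by simp
    have "g i (e i) = g i (\<Oplus>\<^bsub>M\<^esub>j\<in>J. h j (e i) \<odot>\<^bsub>M\<^esub> w j)"
      using basis[OF e[OF i]] by simp
    also have "\<dots> = (\<Oplus>j\<in>J. h j (e i) \<otimes> g i (w j))"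
      by (rule dual_module_finsum[OF g[OF i] \<open>finite J\<close>]) (auto simp: hcl e i w)
    finally show "g i (e i) = (\<Oplus>j\<in>J. h j (e i) \<otimes> g i (w j))" .
  qed (auto intro!: R.finsum_closed simp: hcl gcl e w)
  also have "\<dots> = (\<Oplus>j\<in>J. \<Oplus>i\<in>{..<n}. h j (e i) \<otimes> g i (w j))"
    by (rule R.finsum_swap) (auto simp: \<open>finite J\<close> hcl gcl e w)
  also have "\<dots> = (\<Oplus>j\<in>J. h j (\<phi> (w j)))"
  proof (intro R.finsum_cong' refl)
    fix j assume j: "j \<in> J"
    have "h j (\<phi> (w j)) = h j (\<Oplus>\<^bsub>M\<^esub>i\<in>{..<n}. g i (w j) \<odot>\<^bsub>M\<^esub> e i)"
      using \<phi>[OF w[OF j]] by simp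
    also have "\<dots> = (\<Oplus>i\<in>{..<n}. g i (w j) \<otimes> h j (e i))"
      by (rule dual_module_finsum[OF h[OF j]]) (auto simp: gcl e w j)
    also have "\<dots> = (\<Oplus>i\<in>{..<n}. h j (e i) \<otimes> g i (w j))"
      by (intro R.finsum_cong' refl) (auto simp: gcl hcl e w j R.m_comm)
    finally show "(\<Oplus>i\<in>{..<n}. h j (e i) \<otimes> g i (w j)) = h j (\<phi> (w j))" by simp
  next
    have "\<phi> (w j) \<in> carrier M" if "j \<in> J" for j
      using \<phi>[OF w[OF that]] by (auto intro!: M.finsum_closed simp: gcl e w that)
    then show "(\<lambda>j. h j (\<phi> (w j))) \<in> J \<rightarrow> carrier R" by (auto simp: hcl)
  qed
  finally show ?thesis .
qed

lemma (in module_record) module_trace_eqI: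
  assumes "finite J"
    and "\<And>j. j \<in> J \<Longrightarrow> h j \<in> dual_module R M"
    and "\<And>j. j \<in> J \<Longrightarrow> w j \<in> carrier M"
    and "\<And>m. m \<in> carrier M \<Longrightarrow> m = (\<Oplus>\<^bsub>M\<^esub>j\<in>J. h j m \<odot>\<^bsub>M\<^esub> w j)"
    and "a \<in> trace_values R M \<phi>"
  shows "module_trace R M \<phi> = a"
  unfolding module_trace_def
  using assms(5) trace_value_dual_basis[of J h w _ \<phi>, OF assms(1-4)]
  by (intro the_equality) metis+

section \<open>Free modules and quotient modules\<close>

lemma (in cring) free_module_module: "module R (free_module R :: ('a, 'i \<Rightarrow> 'a) module)"
proof (rule moduleI)
  show "abelian_group (free_module R :: ('a, 'i \<Rightarrow> 'a) module)"
  proof (rule abelian_groupI)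
    fix v :: "'i \<Rightarrow> 'a" assume "v \<in> carrier (free_module R)"
    then show "\<exists>y\<in>carrier (free_module R). y \<oplus>\<^bsub>free_module R\<^esub> v = \<zero>\<^bsub>free_module R\<^esub>"
      by (intro bexI[of _ "\<lambda>i. \<ominus> v i"]) (auto simp: free_module_def Pi_iff l_neg)
  qed (auto simp: free_module_def Pi_iff a_ac fun_eq_iff)
qed (auto simp: free_module_def Pi_iff l_distr r_distr m_assoc is_cring fun_eq_iff)

lemma free_module_simps:
  "v \<in> carrier (free_module R) \<longleftrightarrow> (\<forall>i. v i \<in> carrier R)"
  "(v \<oplus>\<^bsub>free_module R\<^esub> w) i = v i \<oplus>\<^bsub>R\<^esub> w i"
  "(a \<odot>\<^bsub>free_module R\<^esub> v) i = a \<otimes>\<^bsub>R\<^esub> v i"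
  "\<zero>\<^bsub>free_module R\<^esub> i = \<zero>\<^bsub>R\<^esub>"
  by (auto simp: free_module_def Pi_iff)

lemma (in cring) free_module_uminus:
  assumes "v \<in> carrier (free_module R)"
  shows "(\<ominus>\<^bsub>free_module R\<^esub> v) i = \<ominus> v i"
proof -
  interpret F: module R "free_module R" by (rule free_module_module)
  have "(\<ominus>\<^bsub>free_module R\<^esub> v \<oplus>\<^bsub>free_module R\<^esub> v) i = \<zero>"
    using assms by (simp add: F.M.l_neg free_module_simps)
  then show ?thesis
    using assms F.M.a_inv_closed[OF assms] unfolding free_module_simps
    by (metis minus_equality)
qed

lemma (in cring) free_module_minus:
  assumes "v \<in> carrier (free_module R)" "w \<in> carrier (free_module R)"
  shows "(v \<ominus>\<^bsub>free_module R\<^esub> w) i = v i \<ominus> w i"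
  using assms by (simp add: a_minus_def free_module_simps free_module_uminus)

lemma (in cring) free_module_finsum:
  assumes "finite J" "\<And>j. j \<in> J \<Longrightarrow> v j \<in> carrier (free_module R)"
  shows "(\<Oplus>\<^bsub>free_module R\<^esub>j\<in>J. v j) i = (\<Oplus>j\<in>J. v j i)"
proof -
  interpret F: module R "free_module R" by (rule free_module_module)
  show ?thesis using assms
  proof (induction J rule: finite_induct)
    case empty then show ?case by (simp add: free_module_simps)
  next
    case (insert k J)
    then have "(\<Oplus>\<^bsub>free_module R\<^esub>j\<in>insert k J. v j) = v k \<oplus>\<^bsub>free_module R\<^esub> (\<Oplus>\<^bsub>free_module R\<^esub>j\<in>J. v j)"
      by (subst F.M.finsum_insert) auto
    then show ?case using insert
      by (auto simp: free_module_simps Pi_iff)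
  qed
qed

text \<open>
  Computing in the quotient through the class map \<open>cls\<close> keeps sets out of later arguments: each
  operation of the quotient is evaluated at representatives below.
\<close>

locale quotient_module = module_record R M + submodule N R M
  for R (structure) and M :: "('a, 'b) module" (structure) and N
begin

abbreviation Q where "Q \<equiv> quot_module M N"
abbreviation cls where "cls v \<equiv> N +>\<^bsub>M\<^esub> v"

sublocale abelian_subgroup N M
  using additive_subgroup.intro[OF subgroup_axioms] M.abelian_group_axioms
  by (rule abelian_subgroupI3)

lemma cls_closed: "v \<in> carrier M \<Longrightarrow> cls v \<in> carrier Q"
  using a_rcosetsI[OF a_subset] by (simp add: quot_module_def)

lemma cls_cases:
  assumes "C \<in> carrier Q"
  obtains v where "v \<in> carrier M" "C = cls v"
  using assms by (auto simp: quot_module_def A_RCOSETS_def')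

lemma cls_eq_iff:
  assumes "v \<in> carrier M" "w \<in> carrier M"
  shows "cls v = cls w \<longleftrightarrow> v \<ominus>\<^bsub>M\<^esub> w \<in> N"
  using a_rcos_module[OF assms(2,1)] assms unfolding a_minus_def
  by (metis a_rcos_self a_repr_independence')

lemma cls_mem:
  assumes "v \<in> carrier M" "w \<in> cls v"
  shows "w \<in> carrier M" "cls w = cls v"
  using a_elemrcos_carrier[OF assms] a_repr_independence'[OF assms(2,1)] by simp_all

text \<open>
  Scalar multiplication on the quotient and induced operators are given as unions over a coset. When
  the class of \<open>T w\<close> is the same for all representatives \<open>w\<close>, all members of the union coincide.
\<close>

lemma UN_cls:
  assumes "v \<in> carrier M"
    and "\<And>w. w \<in> carrier M \<Longrightarrow> cls w = cls v \<Longrightarrow> cls (T w) = cls (T v)"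
  shows "(\<Union>w\<in>cls v. cls (T w)) = cls (T v)"
proof -
  have "cls (T w) = cls (T v)" if "w \<in> cls v" for w
    using cls_mem[OF assms(1) that] assms(2) by blast
  then show ?thesis using a_rcos_self[OF assms(1)] by blast
qed

lemma cls_add:
  assumes "v \<in> carrier M" "w \<in> carrier M"
  shows "cls v \<oplus>\<^bsub>Q\<^esub> cls w = cls (v \<oplus>\<^bsub>M\<^esub> w)"
  using a_rcos_sum[OF assms] by (simp add: quot_module_def)

lemma cls_smult:
  assumes "a \<in> carrier R" "v \<in> carrier M"
  shows "a \<odot>\<^bsub>Q\<^esub> cls v = cls (a \<odot>\<^bsub>M\<^esub> v)"
proof -
  have "cls (a \<odot>\<^bsub>M\<^esub> w) = cls (a \<odot>\<^bsub>M\<^esub> v)" if "w \<in> carrier M" "cls w = cls v" for w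
  proof -
    have "a \<odot>\<^bsub>M\<^esub> w \<ominus>\<^bsub>M\<^esub> a \<odot>\<^bsub>M\<^esub> v = a \<odot>\<^bsub>M\<^esub> (w \<ominus>\<^bsub>M\<^esub> v)"
      using assms that(1) by (simp add: a_minus_def smult_r_distr smult_r_minus)
    also have "\<dots> \<in> N"
      using that assms cls_eq_iff by (intro submodule.smult_closed[OF submodule_axioms]) auto
    finally show ?thesis using assms that(1) by (simp add: cls_eq_iff)
  qed
  then have "(\<Union>w\<in>cls v. cls (a \<odot>\<^bsub>M\<^esub> w)) = cls (a \<odot>\<^bsub>M\<^esub> v)"
    by (rule UN_cls[OF assms(2)])
  then show ?thesis by (simp only: quot_module_def module.simps)
qed

lemma cls_zero: "\<zero>\<^bsub>Q\<^esub> = cls \<zero>\<^bsub>M\<^esub>"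
  using a_coset_add_zero[OF a_subset] by (simp add: quot_module_def)

lemma quot_module_abelian_group: "abelian_group Q"
proof (rule abelian_groupI)
  show "\<zero>\<^bsub>Q\<^esub> \<in> carrier Q"
    unfolding cls_zero by (intro cls_closed M.zero_closed)
  fix C assume "C \<in> carrier Q"
  then obtain v where v: "v \<in> carrier M" "C = cls v" by (rule cls_cases)
  then show "\<exists>D\<in>carrier Q. D \<oplus>\<^bsub>Q\<^esub> C = \<zero>\<^bsub>Q\<^esub>"
    by (intro bexI[of _ "cls (\<ominus>\<^bsub>M\<^esub> v)"]) (simp_all add: cls_add cls_zero cls_closed M.l_neg)
  show "\<zero>\<^bsub>Q\<^esub> \<oplus>\<^bsub>Q\<^esub> C = C" using v by (simp add: cls_add cls_zero)
  fix D assume "D \<in> carrier Q"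
  then obtain w where w: "w \<in> carrier M" "D = cls w" by (rule cls_cases)
  show "C \<oplus>\<^bsub>Q\<^esub> D \<in> carrier Q" using v w by (simp add: cls_add cls_closed)
  show "C \<oplus>\<^bsub>Q\<^esub> D = D \<oplus>\<^bsub>Q\<^esub> C" using v w by (simp add: cls_add M.a_comm)
  fix E assume "E \<in> carrier Q"
  then obtain u where u: "u \<in> carrier M" "E = cls u" by (rule cls_cases)
  show "C \<oplus>\<^bsub>Q\<^esub> D \<oplus>\<^bsub>Q\<^esub> E = C \<oplus>\<^bsub>Q\<^esub> (D \<oplus>\<^bsub>Q\<^esub> E)" using v w u by (simp add: cls_add M.a_assoc)
qed

lemma quot_module_module: "module R Q"
proof -
  have "module_axioms R Q"
  proof
    show "\<one> \<odot>\<^bsub>Q\<^esub> C = C" if "C \<in> carrier Q" for C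
      using that by (rule cls_cases) (simp add: cls_smult)
    fix a C assume a: "a \<in> carrier R" and C: "C \<in> carrier Q"
    obtain v where v: "v \<in> carrier M" "C = cls v" using C by (rule cls_cases)
    note simps = a v cls_smult cls_add cls_closed
    show "a \<odot>\<^bsub>Q\<^esub> C \<in> carrier Q" by (simp add: simps)
    fix b assume b: "b \<in> carrier R"
    show "(a \<oplus> b) \<odot>\<^bsub>Q\<^esub> C = a \<odot>\<^bsub>Q\<^esub> C \<oplus>\<^bsub>Q\<^esub> b \<odot>\<^bsub>Q\<^esub> C"
      using b by (simp add: simps smult_l_distr)
    show "(a \<otimes> b) \<odot>\<^bsub>Q\<^esub> C = a \<odot>\<^bsub>Q\<^esub> (b \<odot>\<^bsub>Q\<^esub> C)"
      using b by (simp add: simps smult_assoc1)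
  next
    fix a C D assume a: "a \<in> carrier R" and C: "C \<in> carrier Q" and D: "D \<in> carrier Q"
    obtain v where v: "v \<in> carrier M" "C = cls v" using C by (rule cls_cases)
    obtain w where w: "w \<in> carrier M" "D = cls w" using D by (rule cls_cases)
    show "a \<odot>\<^bsub>Q\<^esub> (C \<oplus>\<^bsub>Q\<^esub> D) = a \<odot>\<^bsub>Q\<^esub> C \<oplus>\<^bsub>Q\<^esub> a \<odot>\<^bsub>Q\<^esub> D"
      using a v w by (simp add: cls_add cls_smult smult_r_distr)
  qed
  then show ?thesis
    by (rule module.intro[OF is_cring quot_module_abelian_group])
qed

sublocale Q: module_record R Q by (intro module_record.intro quot_module_module)

lemma cls_minus:
  assumes "v \<in> carrier M" "w \<in> carrier M"
  shows "cls v \<ominus>\<^bsub>Q\<^esub> cls w = cls (v \<ominus>\<^bsub>M\<^esub> w)"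
proof -
  have "cls (\<ominus>\<^bsub>M\<^esub> w) \<oplus>\<^bsub>Q\<^esub> cls w = \<zero>\<^bsub>Q\<^esub>"
    using assms by (simp add: cls_add cls_zero M.l_neg)
  then have "\<ominus>\<^bsub>Q\<^esub> cls w = cls (\<ominus>\<^bsub>M\<^esub> w)"
    using assms by (intro Q.M.minus_equality) (auto simp: cls_closed)
  then show ?thesis using assms by (simp add: a_minus_def cls_add)
qed

lemma cls_finsum:
  assumes "finite J" "\<And>j. j \<in> J \<Longrightarrow> v j \<in> carrier M"
  shows "(\<Oplus>\<^bsub>Q\<^esub>j\<in>J. cls (v j)) = cls (\<Oplus>\<^bsub>M\<^esub>j\<in>J. v j)"
  using assms
proof (induction J rule: finite_induct)
  case empty then show ?case by (simp add: cls_zero)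
next
  case (insert k J)
  then have "(\<Oplus>\<^bsub>Q\<^esub>j\<in>insert k J. cls (v j)) = cls (v k) \<oplus>\<^bsub>Q\<^esub> cls (\<Oplus>\<^bsub>M\<^esub>j\<in>J. v j)"
    by (subst Q.M.finsum_insert) (auto intro: cls_closed)
  also have "\<dots> = cls (v k \<oplus>\<^bsub>M\<^esub> (\<Oplus>\<^bsub>M\<^esub>j\<in>J. v j))"
    using insert by (intro cls_add) (auto intro!: M.finsum_closed)
  also have "v k \<oplus>\<^bsub>M\<^esub> (\<Oplus>\<^bsub>M\<^esub>j\<in>J. v j) = (\<Oplus>\<^bsub>M\<^esub>j\<in>insert k J. v j)"
    using insert by (intro M.finsum_insert[symmetric]) auto
  finally show ?case .
qed

lemma induced_on_quot_cls:
  assumes "v \<in> carrier M"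
    and "\<And>w. w \<in> carrier M \<Longrightarrow> cls w = cls v \<Longrightarrow> cls (T w) = cls (T v)"
  shows "induced_on_quot M N T (cls v) = cls (T v)"
  unfolding induced_on_quot_def by (rule UN_cls) (fact assms)+

end

section \<open>Vectors over a commutative ring and derivations\<close>

definition pairing :: "('a, 'm) ring_scheme \<Rightarrow> ('i \<Rightarrow> 'a) \<Rightarrow> ('i \<Rightarrow> 'a) \<Rightarrow> 'a"
  where "pairing R u v = (\<Oplus>\<^bsub>R\<^esub>i\<in>UNIV. u i \<otimes>\<^bsub>R\<^esub> v i)"

context cring
begin

abbreviation pair (\<open>\<langle>_,_\<rangle>\<close>) where "\<langle>u,v\<rangle> \<equiv> pairing R u v"

lemma pairing_closed [simp, intro]:
  assumes "\<And>i. u i \<in> carrier R" "\<And>i. v i \<in> carrier R"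
  shows "\<langle>u,v\<rangle> \<in> carrier R"
  using assms unfolding pairing_def by (auto intro!: finsum_closed)

lemma pairing_comm:
  assumes "\<And>i. u i \<in> carrier R" "\<And>i. v i \<in> carrier R"
  shows "\<langle>u,v\<rangle> = \<langle>v,u\<rangle>"
  using assms unfolding pairing_def by (intro finsum_cong') (auto simp: m_comm)

lemma pairing_add_right:
  assumes "\<And>i. u i \<in> carrier R" "\<And>i. v i \<in> carrier R" "\<And>i. w i \<in> carrier R"
  shows "\<langle>u,\<lambda>i. v i \<oplus> w i\<rangle> = \<langle>u,v\<rangle> \<oplus> \<langle>u,w\<rangle>"
proof -
  have "\<langle>u,\<lambda>i. v i \<oplus> w i\<rangle> = (\<Oplus>i\<in>UNIV. u i \<otimes> v i \<oplus> u i \<otimes> w i)"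
    unfolding pairing_def using assms by (intro finsum_cong') (auto simp: r_distr)
  also have "\<dots> = \<langle>u,v\<rangle> \<oplus> \<langle>u,w\<rangle>"
    unfolding pairing_def using assms by (intro finsum_addf) auto
  finally show ?thesis .
qed

lemma pairing_smult_right:
  fixes u v :: "'i::finite \<Rightarrow> 'a"
  assumes "\<And>i. u i \<in> carrier R" "\<And>i. v i \<in> carrier R" "a \<in> carrier R"
  shows "\<langle>u,\<lambda>i. a \<otimes> v i\<rangle> = a \<otimes> \<langle>u,v\<rangle>"
proof -
  have "\<langle>u,\<lambda>i. a \<otimes> v i\<rangle> = (\<Oplus>i\<in>UNIV. a \<otimes> (u i \<otimes> v i))"
    unfolding pairing_def using assms by (intro finsum_cong') (auto simp: m_lcomm)
  also have "\<dots> = a \<otimes> \<langle>u,v\<rangle>"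
    unfolding pairing_def using assms by (intro finsum_rdistr[symmetric]) auto
  finally show ?thesis .
qed

lemma pairing_uminus_right:
  fixes u v :: "'i::finite \<Rightarrow> 'a"
  assumes "\<And>i. u i \<in> carrier R" "\<And>i. v i \<in> carrier R"
  shows "\<langle>u,\<lambda>i. \<ominus> v i\<rangle> = \<ominus> \<langle>u,v\<rangle>"
  using pairing_smult_right[of u v "\<ominus> \<one>"] assms by (simp add: l_minus)

lemma pairing_minus_right:
  fixes u v w :: "'i::finite \<Rightarrow> 'a"
  assumes "\<And>i. u i \<in> carrier R" "\<And>i. v i \<in> carrier R" "\<And>i. w i \<in> carrier R"
  shows "\<langle>u,\<lambda>i. v i \<ominus> w i\<rangle> = \<langle>u,v\<rangle> \<ominus> \<langle>u,w\<rangle>"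
  using assms by (simp add: minus_eq pairing_add_right pairing_uminus_right)

lemma pairing_add_left:
  assumes "\<And>i. u i \<in> carrier R" "\<And>i. v i \<in> carrier R" "\<And>i. w i \<in> carrier R"
  shows "\<langle>\<lambda>i. u i \<oplus> w i,v\<rangle> = \<langle>u,v\<rangle> \<oplus> \<langle>w,v\<rangle>"
  using pairing_add_right[of v u w] assms by (simp add: pairing_comm[of _ v])

lemma pairing_smult_left:
  fixes u v :: "'i::finite \<Rightarrow> 'a"
  assumes "\<And>i. u i \<in> carrier R" "\<And>i. v i \<in> carrier R" "a \<in> carrier R"
  shows "\<langle>\<lambda>i. a \<otimes> u i,v\<rangle> = a \<otimes> \<langle>u,v\<rangle>"
  using pairing_smult_right[of v u a] assms by (simp add: pairing_comm[of _ v])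

lemma pairing_unit:
  fixes v :: "'i::finite \<Rightarrow> 'a"
  assumes "\<And>i. v i \<in> carrier R"
  shows "\<langle>\<lambda>i. if k = i then \<one> else \<zero>,v\<rangle> = v k"
proof -
  have "\<langle>\<lambda>i. if k = i then \<one> else \<zero>,v\<rangle> = (\<Oplus>i\<in>UNIV. if k = i then v i else \<zero>)"
    unfolding pairing_def using assms by (intro finsum_cong') auto
  also have "\<dots> = v k"
    using assms by (intro finsum_singleton) auto
  finally show ?thesis .
qed

end

locale derivation = cring R
  for R :: "('a, 'm) ring_scheme" (structure) and \<iota> :: "'k \<Rightarrow> 'a" and \<delta> :: "'a \<Rightarrow> 'a" +
  assumes derivation: "\<delta> \<in> derivations \<iota> R"
begin

lemma der_closed [simp, intro]: "a \<in> carrier R \<Longrightarrow> \<delta> a \<in> carrier R"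
  and der_add: "a \<in> carrier R \<Longrightarrow> b \<in> carrier R \<Longrightarrow> \<delta> (a \<oplus> b) = \<delta> a \<oplus> \<delta> b"
  and der_mult: "a \<in> carrier R \<Longrightarrow> b \<in> carrier R \<Longrightarrow> \<delta> (a \<otimes> b) = \<delta> a \<otimes> b \<oplus> a \<otimes> \<delta> b"
  and der_scalar: "a \<in> carrier R \<Longrightarrow> \<delta> (\<iota> c \<otimes> a) = \<iota> c \<otimes> \<delta> a"
  using derivation by (auto simp: derivations_def)

lemma der_zero: "\<delta> \<zero> = \<zero>"
  using der_add[of \<zero> \<zero>] by simp

lemma der_one: "\<delta> \<one> = \<zero>"
  using der_mult[of \<one> \<one>] by simp

lemma der_minus:
  assumes "a \<in> carrier R" "b \<in> carrier R"
  shows "\<delta> (a \<ominus> b) = \<delta> a \<ominus> \<delta> b"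
proof -
  have "\<delta> (\<ominus> b) \<oplus> \<delta> b = \<zero>"
    using assms der_add[of "\<ominus> b" b] by (simp add: l_neg der_zero)
  then have "\<delta> (\<ominus> b) = \<ominus> \<delta> b"
    using assms by (simp add: sum_zero_eq_neg)
  then show ?thesis
    using assms by (simp add: minus_eq der_add)
qed

lemma der_finsum:
  assumes "finite I" "\<And>i. i \<in> I \<Longrightarrow> c i \<in> carrier R"
  shows "\<delta> (\<Oplus>i\<in>I. c i) = (\<Oplus>i\<in>I. \<delta> (c i))"
  using assms
proof (induction I rule: finite_induct)
  case empty then show ?case by (simp add: der_zero)
next
  case (insert k I)
  then have "(\<Oplus>i\<in>insert k I. c i) = c k \<oplus> (\<Oplus>i\<in>I. c i)" "(\<Oplus>i\<in>I. c i) \<in> carrier R"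
    "(\<Oplus>i\<in>insert k I. \<delta> (c i)) = \<delta> (c k) \<oplus> (\<Oplus>i\<in>I. \<delta> (c i))"
    by (auto intro!: finsum_insert finsum_closed)
  then show ?case using insert by (simp add: der_add)
qed

lemma der_pairing:
  fixes u v :: "'i::finite \<Rightarrow> 'a"
  assumes "\<And>i. u i \<in> carrier R" "\<And>i. v i \<in> carrier R"
  shows "\<delta> \<langle>u,v\<rangle> = \<langle>\<lambda>i. \<delta> (u i),v\<rangle> \<oplus> \<langle>u,\<lambda>i. \<delta> (v i)\<rangle>"
proof -
  have "\<delta> \<langle>u,v\<rangle> = (\<Oplus>i\<in>UNIV. \<delta> (u i \<otimes> v i))"
    unfolding pairing_def using assms by (intro der_finsum) auto
  also have "\<dots> = (\<Oplus>i\<in>UNIV. \<delta> (u i) \<otimes> v i \<oplus> u i \<otimes> \<delta> (v i))"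
    using assms by (intro finsum_cong') (auto simp: der_mult)
  also have "\<dots> = \<langle>\<lambda>i. \<delta> (u i),v\<rangle> \<oplus> \<langle>u,\<lambda>i. \<delta> (v i)\<rangle>"
    unfolding pairing_def using assms by (intro finsum_addf) auto
  finally show ?thesis .
qed

end

lemma (in cring) der_bracket_derivation:
  assumes "\<And>c. \<iota> c \<in> carrier R" "\<delta> \<in> derivations \<iota> R" "\<eta> \<in> derivations \<iota> R"
  shows "der_bracket R \<delta> \<eta> \<in> derivations \<iota> R"
proof -
  interpret D: derivation R \<iota> \<delta> by unfold_locales fact
  interpret E: derivation R \<iota> \<eta> by unfold_locales fact
  note der = D.der_add E.der_add D.der_mult E.der_mult D.der_scalar E.der_scalar
  have add: "\<delta> (\<eta> (a \<oplus> b)) \<ominus> \<eta> (\<delta> (a \<oplus> b)) = \<delta> (\<eta> a) \<ominus> \<eta> (\<delta> a) \<oplus> (\<delta> (\<eta> b) \<ominus> \<eta> (\<delta> b))"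
    and mult: "\<delta> (\<eta> (a \<otimes> b)) \<ominus> \<eta> (\<delta> (a \<otimes> b)) =
      (\<delta> (\<eta> a) \<ominus> \<eta> (\<delta> a)) \<otimes> b \<oplus> a \<otimes> (\<delta> (\<eta> b) \<ominus> \<eta> (\<delta> b))"
    if a: "a \<in> carrier R" and b: "b \<in> carrier R" for a b
  proof -
    have cl: "\<delta> a \<in> carrier R" "\<eta> a \<in> carrier R" "\<delta> (\<eta> a) \<in> carrier R" "\<eta> (\<delta> a) \<in> carrier R"
      "\<delta> b \<in> carrier R" "\<eta> b \<in> carrier R" "\<delta> (\<eta> b) \<in> carrier R" "\<eta> (\<delta> b) \<in> carrier R"
      using a b by auto
    show "\<delta> (\<eta> (a \<oplus> b)) \<ominus> \<eta> (\<delta> (a \<oplus> b)) = \<delta> (\<eta> a) \<ominus> \<eta> (\<delta> a) \<oplus> (\<delta> (\<eta> b) \<ominus> \<eta> (\<delta> b))"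
      using cl by (simp only: der a b) algebra
    have "\<delta> (\<eta> (a \<otimes> b)) = \<delta> (\<eta> a) \<otimes> b \<oplus> \<eta> a \<otimes> \<delta> b \<oplus> (\<delta> a \<otimes> \<eta> b \<oplus> a \<otimes> \<delta> (\<eta> b))"
      "\<eta> (\<delta> (a \<otimes> b)) = \<eta> (\<delta> a) \<otimes> b \<oplus> \<delta> a \<otimes> \<eta> b \<oplus> (\<eta> a \<otimes> \<delta> b \<oplus> a \<otimes> \<eta> (\<delta> b))"
      using a b by (simp_all add: der)
    then show "\<delta> (\<eta> (a \<otimes> b)) \<ominus> \<eta> (\<delta> (a \<otimes> b)) =
        (\<delta> (\<eta> a) \<ominus> \<eta> (\<delta> a)) \<otimes> b \<oplus> a \<otimes> (\<delta> (\<eta> b) \<ominus> \<eta> (\<delta> b))"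
      using cl a b by (simp only:) algebra
  qed
  have scalar: "\<delta> (\<eta> (\<iota> c \<otimes> a)) \<ominus> \<eta> (\<delta> (\<iota> c \<otimes> a)) = \<iota> c \<otimes> (\<delta> (\<eta> a) \<ominus> \<eta> (\<delta> a))"
    if "a \<in> carrier R" for a c
    using that assms(1)[of c] by (simp add: D.der_scalar E.der_scalar minus_eq r_distr r_minus)
  show ?thesis
    unfolding derivations_def der_bracket_def using add scalar mult by auto
qed

section \<open>The connection on the quotient by a unimodular vector\<close>

text \<open>
  The geometry enters only through a vector \<open>f\<close> and a linear form \<open>e\<close> with \<open>\<langle>e,f\<rangle> = 1\<close>. The matrix
  \<open>proj = 1 - f e\<close> is then the projection along the line spanned by \<open>f\<close>, so its image is isomorphic
  to the quotient by that line, which is therefore projective. For the hypersurface, \<open>f\<close> is the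
  gradient of \<open>F\<close> and \<open>e = (x/p, y/q, z/r)\<close>, and \<open>\<langle>e,f\<rangle> = 1\<close> is the weighted Euler relation.
\<close>

locale unimodular_vector = cring R
  for R :: "('a, 'm) ring_scheme" (structure) +
  fixes f e :: "'i::finite \<Rightarrow> 'a"
  assumes f_closed [simp, intro]: "f i \<in> carrier R"
    and e_closed [simp, intro]: "e i \<in> carrier R"
    and pairing_e_f: "\<langle>e,f\<rangle> = \<one>"
begin

definition proj :: "'i \<Rightarrow> 'i \<Rightarrow> 'a"
  where "proj i j = (if i = j then \<one> else \<zero>) \<ominus> f i \<otimes> e j"

definition f_line :: "('i \<Rightarrow> 'a) set"
  where "f_line = {a \<odot>\<^bsub>free_module R\<^esub> f | a. a \<in> carrier R}"

definition conn_lift :: "('a \<Rightarrow> 'a) \<Rightarrow> ('i \<Rightarrow> 'a) \<Rightarrow> 'i \<Rightarrow> 'a"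
  where "conn_lift \<delta> v = (\<lambda>i. \<delta> (v i)) \<oplus>\<^bsub>free_module R\<^esub> (\<lambda>i. \<Oplus>j\<in>UNIV. \<delta> (proj i j) \<otimes> v j)"

lemma f_line_submodule: "submodule f_line R (free_module R)"
proof -
  interpret F: module R "free_module R :: ('a, 'i \<Rightarrow> 'a) module"
    by (rule free_module_module)
  have f: "f \<in> carrier (free_module R)" by (simp add: free_module_simps)
  show ?thesis
  proof (rule F.submoduleI)
    show "f_line \<subseteq> carrier (free_module R)"
      using f by (auto simp: f_line_def)
    have "\<zero>\<^bsub>free_module R\<^esub> = \<zero> \<odot>\<^bsub>free_module R\<^esub> f"
      using f by simp
    then show "\<zero>\<^bsub>free_module R\<^esub> \<in> f_line"
      unfolding f_line_def by blast
    show "\<ominus>\<^bsub>free_module R\<^esub> u \<in> f_line" if "u \<in> f_line" for u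
      using that f unfolding f_line_def by (auto simp flip: F.smult_l_minus)
    show "u \<oplus>\<^bsub>free_module R\<^esub> w \<in> f_line" if "u \<in> f_line" "w \<in> f_line" for u w
      using that f unfolding f_line_def by (auto simp flip: F.smult_l_distr)
    show "a \<odot>\<^bsub>free_module R\<^esub> u \<in> f_line" if "a \<in> carrier R" "u \<in> f_line" for a u
      using that f unfolding f_line_def by (auto simp flip: F.smult_assoc1)
  qed
qed

sublocale E: quotient_module R "free_module R" f_line
  by (intro quotient_module.intro module_record.intro free_module_module f_line_submodule)

lemma cls_eqI:
  assumes "\<And>i. v i \<in> carrier R" "\<And>i. w i \<in> carrier R" "a \<in> carrier R"
    and "\<And>i. v i = w i \<oplus> a \<otimes> f i"
  shows "E.cls v = E.cls w"
proof -
  have "(v \<ominus>\<^bsub>free_module R\<^esub> w) i = (a \<odot>\<^bsub>free_module R\<^esub> f) i" for i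
  proof -
    have "w i \<oplus> a \<otimes> f i \<ominus> w i = a \<otimes> f i"
      using assms(2)[of i] assms(3) f_closed[of i] by algebra
    then show ?thesis
      using assms by (simp add: free_module_minus free_module_simps)
  qed
  then have "v \<ominus>\<^bsub>free_module R\<^esub> w = a \<odot>\<^bsub>free_module R\<^esub> f" by blast
  then show ?thesis
    using assms(1-3) by (subst E.cls_eq_iff) (auto simp: free_module_simps f_line_def)
qed

lemma cls_eqD:
  assumes "\<And>i. v i \<in> carrier R" "\<And>i. w i \<in> carrier R" "E.cls v = E.cls w"
  shows "\<exists>a\<in>carrier R. \<forall>i. v i = w i \<oplus> a \<otimes> f i"
proof -
  have "v \<ominus>\<^bsub>free_module R\<^esub> w \<in> f_line"
    using assms by (subst E.cls_eq_iff[symmetric]) (auto simp: free_module_simps)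
  then obtain a where a: "a \<in> carrier R" "v \<ominus>\<^bsub>free_module R\<^esub> w = a \<odot>\<^bsub>free_module R\<^esub> f"
    by (auto simp: f_line_def)
  have "v i = w i \<oplus> a \<otimes> f i" for i
  proof -
    have "v i \<ominus> w i = a \<otimes> f i"
      using assms fun_cong[OF a(2), of i] by (simp add: free_module_minus free_module_simps)
    moreover have "v i = w i \<oplus> (v i \<ominus> w i)"
      using assms(1)[of i] assms(2)[of i] by algebra
    ultimately show ?thesis by simp
  qed
  with a(1) show ?thesis by blast
qed

text \<open>
  If \<open>\<langle>u,f\<rangle> = 0\<close>, then \<open>\<langle>u,_\<rangle>\<close> is constant on each class, and \<open>form u\<close> is the linear form on the
  quotient that \<open>u\<close> induces.
\<close>

definition form :: "('i \<Rightarrow> 'a) \<Rightarrow> ('i \<Rightarrow> 'a) set \<Rightarrow> 'a"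
  where "form u C = (THE a. \<exists>v\<in>C. a = \<langle>u,v\<rangle>)"

lemma form_cls:
  assumes u: "\<And>i. u i \<in> carrier R" "\<langle>u,f\<rangle> = \<zero>" and v: "\<And>i. v i \<in> carrier R"
  shows "form u (E.cls v) = \<langle>u,v\<rangle>"
proof -
  have v': "v \<in> carrier (free_module R)" using v by (simp add: free_module_simps)
  have "\<langle>u,w\<rangle> = \<langle>u,v\<rangle>" if w: "w \<in> E.cls v" for w
  proof -
    have wc: "\<And>i. w i \<in> carrier R" and "E.cls w = E.cls v"
      using E.cls_mem[OF v' w] by (auto simp: free_module_simps)
    then obtain a where a: "a \<in> carrier R" "\<forall>i. w i = v i \<oplus> a \<otimes> f i"
      using cls_eqD[of w v] v by blast
    have "w = (\<lambda>i. v i \<oplus> a \<otimes> f i)" using a(2) by blast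
    then show ?thesis
      using u v a(1) by (simp add: pairing_add_right pairing_smult_right)
  qed
  moreover have "v \<in> E.cls v" by (rule E.a_rcos_self[OF v'])
  ultimately show ?thesis unfolding form_def by (intro the_equality) blast+
qed

lemma form_dual:
  assumes u: "\<And>i. u i \<in> carrier R" "\<langle>u,f\<rangle> = \<zero>"
  shows "form u \<in> dual_module R E.Q"
proof -
  have add: "form u (C \<oplus>\<^bsub>E.Q\<^esub> D) = form u C \<oplus> form u D"
    if C: "C \<in> carrier E.Q" and D: "D \<in> carrier E.Q" for C D
  proof -
    obtain v where v: "v \<in> carrier (free_module R)" "C = E.cls v" using C by (rule E.cls_cases)
    obtain w where w: "w \<in> carrier (free_module R)" "D = E.cls w" using D by (rule E.cls_cases)
    have vw: "v \<oplus>\<^bsub>free_module R\<^esub> w = (\<lambda>i. v i \<oplus> w i)" by (simp add: free_module_def)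
    show ?thesis
      using v(1) w(1) unfolding v(2) w(2) E.cls_add[OF v(1) w(1)] vw
      by (simp add: free_module_simps form_cls u pairing_add_right)
  qed
  have smult: "form u (a \<odot>\<^bsub>E.Q\<^esub> C) = a \<otimes> form u C" and closed: "form u C \<in> carrier R"
    if a: "a \<in> carrier R" and C: "C \<in> carrier E.Q" for a C
  proof -
    obtain v where v: "v \<in> carrier (free_module R)" "C = E.cls v" using C by (rule E.cls_cases)
    have av: "a \<odot>\<^bsub>free_module R\<^esub> v = (\<lambda>i. a \<otimes> v i)" by (simp add: free_module_def)
    show "form u (a \<odot>\<^bsub>E.Q\<^esub> C) = a \<otimes> form u C"
      using v(1) a unfolding v(2) E.cls_smult[OF a v(1)] av
      by (simp add: free_module_simps form_cls u pairing_smult_right)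
    show "form u C \<in> carrier R"
      using v(1) unfolding v(2) by (simp add: free_module_simps form_cls u pairing_closed)
  qed
  show ?thesis
    using add smult closed[OF one_closed] by (auto simp: dual_module_def)
qed

definition conn :: "('a \<Rightarrow> 'a) \<Rightarrow> ('i \<Rightarrow> 'a) set \<Rightarrow> ('i \<Rightarrow> 'a) set"
  where "conn \<delta> = induced_on_quot (free_module R) f_line (conn_lift \<delta>)"

text \<open>
  Modulo the line spanned by \<open>f\<close>, the operator \<open>D\<^sub>\<delta> + \<delta>(proj)\<close> simplifies: since
  \<open>\<delta>(proj) v = - \<langle>e,v\<rangle> \<delta>(f) - \<langle>\<delta>(e),v\<rangle> f\<close>, the last term can be dropped. What remains no longer
  involves \<open>\<delta>(e)\<close>, and this is what makes the curvature computable by hand.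
\<close>

definition reduced :: "('a \<Rightarrow> 'a) \<Rightarrow> ('i \<Rightarrow> 'a) \<Rightarrow> 'i \<Rightarrow> 'a"
  where "reduced \<delta> v = (\<lambda>i. \<delta> (v i) \<ominus> \<langle>e,v\<rangle> \<otimes> \<delta> (f i))"

lemma reduced_closed:
  assumes "\<delta> \<in> derivations \<iota> R" "\<And>i. v i \<in> carrier R"
  shows "reduced \<delta> v i \<in> carrier R"
proof -
  interpret D: derivation R \<iota> \<delta> by unfold_locales fact
  show ?thesis using assms(2) by (simp add: reduced_def pairing_closed)
qed

lemma conn_lift_eq_reduced:
  assumes \<delta>: "\<delta> \<in> derivations \<iota> R" and v: "\<And>i. v i \<in> carrier R"
  shows "conn_lift \<delta> v i = reduced \<delta> v i \<oplus> (\<ominus> \<langle>\<lambda>j. \<delta> (e j),v\<rangle>) \<otimes> f i"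
proof -
  interpret D: derivation R \<iota> \<delta> by unfold_locales fact
  have proj: "\<delta> (proj i j) = \<ominus> \<delta> (f i) \<otimes> e j \<oplus> \<ominus> f i \<otimes> \<delta> (e j)" for j
  proof -
    have "\<delta> (if i = j then \<one> else \<zero>) = \<zero>"
      by (simp add: D.der_zero D.der_one)
    then have "\<delta> (proj i j) = \<zero> \<ominus> (\<delta> (f i) \<otimes> e j \<oplus> f i \<otimes> \<delta> (e j))"
      unfolding proj_def by (subst D.der_minus) (auto simp: D.der_mult)
    then show ?thesis by (simp add: minus_eq minus_add l_minus)
  qed
  have "(\<Oplus>j\<in>UNIV. \<delta> (proj i j) \<otimes> v j) = \<langle>\<lambda>j. \<ominus> \<delta> (f i) \<otimes> e j \<oplus> \<ominus> f i \<otimes> \<delta> (e j),v\<rangle>"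
    by (simp only: proj pairing_def)
  also have "\<dots> = \<ominus> \<delta> (f i) \<otimes> \<langle>e,v\<rangle> \<oplus> \<ominus> f i \<otimes> \<langle>\<lambda>j. \<delta> (e j),v\<rangle>"
    using v by (subst pairing_add_left) (auto simp: pairing_smult_left)
  finally have sum: "(\<Oplus>j\<in>UNIV. \<delta> (proj i j) \<otimes> v j) =
      \<ominus> \<delta> (f i) \<otimes> \<langle>e,v\<rangle> \<oplus> \<ominus> f i \<otimes> \<langle>\<lambda>j. \<delta> (e j),v\<rangle>" .
  have "a \<oplus> (\<ominus> b \<otimes> c \<oplus> \<ominus> d \<otimes> g) = (a \<ominus> c \<otimes> b) \<oplus> \<ominus> g \<otimes> d"
    if "a \<in> carrier R" "b \<in> carrier R" "c \<in> carrier R" "d \<in> carrier R" "g \<in> carrier R" for a b c d g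
    using that by algebra
  then show ?thesis
    unfolding conn_lift_def free_module_simps sum reduced_def using v by (simp add: pairing_closed)
qed

text \<open>
  The connection descends to the quotient: moving \<open>w\<close> by \<open>a f\<close> moves its image under the reduced
  operator by \<open>\<delta>(a) f + a \<delta>(f) - \<langle>e,a f\<rangle> \<delta>(f)\<close>, where the last two terms cancel because \<open>\<langle>e,f\<rangle> = 1\<close>.
\<close>

lemma reduced_add_line:
  assumes \<delta>: "\<delta> \<in> derivations \<iota> R" and w: "\<And>i. w i \<in> carrier R" and a: "a \<in> carrier R"
  shows "reduced \<delta> (\<lambda>i. w i \<oplus> a \<otimes> f i) i = reduced \<delta> w i \<oplus> \<delta> a \<otimes> f i"
proof -
  interpret D: derivation R \<iota> \<delta> by unfold_locales fact
  have e: "\<langle>e,\<lambda>i. w i \<oplus> a \<otimes> f i\<rangle> = \<langle>e,w\<rangle> \<oplus> a"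
    using w a by (simp add: pairing_add_right pairing_smult_right pairing_e_f)
  have d: "\<delta> (w i \<oplus> a \<otimes> f i) = \<delta> (w i) \<oplus> (\<delta> a \<otimes> f i \<oplus> a \<otimes> \<delta> (f i))"
    using w a by (simp add: D.der_add D.der_mult)
  have "\<delta> (w i) \<in> carrier R" "\<delta> (f i) \<in> carrier R" "\<langle>e,w\<rangle> \<in> carrier R" "f i \<in> carrier R"
    "\<delta> a \<in> carrier R" "a \<in> carrier R"
    using w a by (auto intro!: pairing_closed)
  then show ?thesis
    unfolding reduced_def e d by algebra
qed

lemma conn_cls:
  assumes \<delta>: "\<delta> \<in> derivations \<iota> R" and v: "\<And>i. v i \<in> carrier R"
  shows "conn \<delta> (E.cls v) = E.cls (reduced \<delta> v)"
proof -
  interpret D: derivation R \<iota> \<delta> by unfold_locales fact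
  have conn_lift_closed: "conn_lift \<delta> w i \<in> carrier R" if "\<And>i. w i \<in> carrier R" for w i
    using that by (simp add: conn_lift_eq_reduced[OF \<delta>] reduced_closed[OF \<delta>] pairing_closed)
  have lift_cls: "E.cls (conn_lift \<delta> w) = E.cls (reduced \<delta> w)" if w: "\<And>i. w i \<in> carrier R" for w
    by (rule cls_eqI[where a = "\<ominus> \<langle>\<lambda>j. \<delta> (e j),w\<rangle>"])
      (auto intro!: conn_lift_closed reduced_closed[OF \<delta>] conn_lift_eq_reduced[OF \<delta>] w pairing_closed)
  have wd: "E.cls (conn_lift \<delta> w) = E.cls (conn_lift \<delta> v)"
    if "w \<in> carrier (free_module R)" and eq: "E.cls w = E.cls v" for w
  proof -
    have w: "\<And>i. w i \<in> carrier R" using that(1) by (simp add: free_module_simps)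
    obtain a where a: "a \<in> carrier R" "\<forall>i. w i = v i \<oplus> a \<otimes> f i"
      using cls_eqD[OF w v eq] by blast
    then have "w = (\<lambda>i. v i \<oplus> a \<otimes> f i)" by blast
    then have "reduced \<delta> w i = reduced \<delta> v i \<oplus> \<delta> a \<otimes> f i" for i
      using reduced_add_line[OF \<delta> v a(1)] by simp
    then have "E.cls (reduced \<delta> w) = E.cls (reduced \<delta> v)"
      using a(1) by (intro cls_eqI[where a = "\<delta> a"] reduced_closed[OF \<delta>] w v D.der_closed)
    then show ?thesis unfolding lift_cls[OF w] lift_cls[OF v] .
  qed
  have "v \<in> carrier (free_module R)" using v by (simp add: free_module_simps)
  then have "conn \<delta> (E.cls v) = E.cls (conn_lift \<delta> v)"
    unfolding conn_def using wd by (rule E.induced_on_quot_cls)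
  then show ?thesis unfolding lift_cls[OF v] .
qed

section \<open>The curvature and its trace\<close>

text \<open>
  The row vector \<open>\<delta>(e) + \<langle>e,\<delta>(f)\<rangle> e\<close> is \<open>\<delta>(e)\<close> corrected by a multiple of \<open>e\<close> so as to vanish on
  \<open>f\<close>, hence to induce a form on the quotient. These forms and the classes of \<open>\<delta>(f)\<close> are the factors
  of the curvature in \<open>curv_cls\<close>.
\<close>

definition curv_form :: "('a \<Rightarrow> 'a) \<Rightarrow> 'i \<Rightarrow> 'a"
  where "curv_form \<delta> = (\<lambda>i. \<delta> (e i) \<oplus> \<langle>e,\<lambda>j. \<delta> (f j)\<rangle> \<otimes> e i)"

lemma pairing_curv_form:
  assumes \<delta>: "\<delta> \<in> derivations \<iota> R" and v: "\<And>i. v i \<in> carrier R"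
  shows "\<langle>curv_form \<delta>,v\<rangle> = \<langle>\<lambda>i. \<delta> (e i),v\<rangle> \<oplus> \<langle>e,\<lambda>i. \<delta> (f i)\<rangle> \<otimes> \<langle>e,v\<rangle>"
proof -
  interpret D: derivation R \<iota> \<delta> by unfold_locales fact
  show ?thesis
    unfolding curv_form_def using v
    by (subst pairing_add_left) (auto simp: pairing_smult_left intro!: pairing_closed)
qed

lemma curv_form_closed:
  assumes \<delta>: "\<delta> \<in> derivations \<iota> R"
  shows "curv_form \<delta> i \<in> carrier R"
proof -
  interpret D: derivation R \<iota> \<delta> by unfold_locales fact
  show ?thesis by (auto simp: curv_form_def intro!: pairing_closed)
qed

text \<open>This is \<open>\<delta>\<close> applied to \<open>\<langle>e,f\<rangle> = 1\<close>.\<close>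

lemma pairing_curv_form_f:
  assumes \<delta>: "\<delta> \<in> derivations \<iota> R"
  shows "\<langle>curv_form \<delta>,f\<rangle> = \<zero>"
proof -
  interpret D: derivation R \<iota> \<delta> by unfold_locales fact
  have "\<delta> \<langle>e,f\<rangle> = \<langle>\<lambda>i. \<delta> (e i),f\<rangle> \<oplus> \<langle>e,\<lambda>i. \<delta> (f i)\<rangle>"
    by (rule D.der_pairing) auto
  then show ?thesis
    by (simp add: pairing_curv_form[OF \<delta>] pairing_e_f D.der_one pairing_closed)
qed

definition curv :: "('a \<Rightarrow> 'a) \<Rightarrow> ('a \<Rightarrow> 'a) \<Rightarrow> ('i \<Rightarrow> 'a) set \<Rightarrow> ('i \<Rightarrow> 'a) set"
  where "curv \<delta> \<eta> = (\<lambda>\<omega>. (conn \<delta> (conn \<eta> \<omega>) \<ominus>\<^bsub>E.Q\<^esub> conn \<eta> (conn \<delta> \<omega>))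
      \<ominus>\<^bsub>E.Q\<^esub> conn (der_bracket R \<delta> \<eta>) \<omega>)"

lemma reduced_reduced:
  assumes \<delta>: "\<delta> \<in> derivations \<iota> R" and \<eta>: "\<eta> \<in> derivations \<iota> R"
    and v: "\<And>i. v i \<in> carrier R"
  shows "reduced \<delta> (reduced \<eta> v) i = \<delta> (\<eta> (v i)) \<ominus>
    ((\<langle>\<lambda>i. \<delta> (e i),v\<rangle> \<oplus> \<langle>e,\<lambda>i. \<delta> (v i)\<rangle>) \<otimes> \<eta> (f i) \<oplus> \<langle>e,v\<rangle> \<otimes> \<delta> (\<eta> (f i))) \<ominus>
    (\<langle>e,\<lambda>i. \<eta> (v i)\<rangle> \<ominus> \<langle>e,v\<rangle> \<otimes> \<langle>e,\<lambda>i. \<eta> (f i)\<rangle>) \<otimes> \<delta> (f i)"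
proof -
  interpret D: derivation R \<iota> \<delta> by unfold_locales fact
  interpret G: derivation R \<iota> \<eta> by unfold_locales fact
  have "\<langle>e,reduced \<eta> v\<rangle> = \<langle>e,\<lambda>i. \<eta> (v i)\<rangle> \<ominus> \<langle>e,v\<rangle> \<otimes> \<langle>e,\<lambda>i. \<eta> (f i)\<rangle>"
    unfolding reduced_def using v
    by (subst pairing_minus_right) (auto simp: pairing_smult_right intro!: pairing_closed)
  moreover have "\<delta> (reduced \<eta> v i) = \<delta> (\<eta> (v i)) \<ominus>
      ((\<langle>\<lambda>i. \<delta> (e i),v\<rangle> \<oplus> \<langle>e,\<lambda>i. \<delta> (v i)\<rangle>) \<otimes> \<eta> (f i) \<oplus> \<langle>e,v\<rangle> \<otimes> \<delta> (\<eta> (f i)))"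
    unfolding reduced_def using v
    by (simp add: D.der_minus D.der_mult D.der_pairing pairing_closed)
  ultimately show ?thesis by (subst reduced_def) simp
qed

text \<open>
  The coordinates of the curvature, with one variable for each function occurring in them:
  \<open>d\<close>, \<open>h\<close>, \<open>e\<close> abbreviate \<open>\<delta>\<close>, \<open>\<eta>\<close>, pairing with \<open>e\<close>, so that \<open>dhv\<close>, \<open>edf\<close>, \<open>hev\<close> stand for
  \<open>\<delta>(\<eta>(v\<^sub>i))\<close>, \<open>\<langle>e,\<delta>(f)\<rangle>\<close>, \<open>\<langle>\<eta>(e),v\<rangle>\<close>. The second order terms cancel against the bracket, and so
  do the terms \<open>\<langle>e,\<delta>(v)\<rangle> \<eta>(f)\<close> and \<open>\<langle>e,\<eta>(v)\<rangle> \<delta>(f)\<close> that are not linear over the ring in \<open>v\<close>.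
\<close>

lemma curv_cancellation:
  assumes cl: "dhv \<in> carrier R" "hdv \<in> carrier R" "df \<in> carrier R" "hf \<in> carrier R"
    "dhf \<in> carrier R" "hdf \<in> carrier R" "ev \<in> carrier R" "edv \<in> carrier R" "ehv \<in> carrier R"
    "edf \<in> carrier R" "ehf \<in> carrier R" "dev \<in> carrier R" "hev \<in> carrier R"
  shows "(dhv \<ominus> ((dev \<oplus> edv) \<otimes> hf \<oplus> ev \<otimes> dhf) \<ominus> (ehv \<ominus> ev \<otimes> ehf) \<otimes> df
      \<ominus> (hdv \<ominus> ((hev \<oplus> ehv) \<otimes> df \<oplus> ev \<otimes> hdf) \<ominus> (edv \<ominus> ev \<otimes> edf) \<otimes> hf))
      \<ominus> (dhv \<ominus> hdv \<ominus> ev \<otimes> (dhf \<ominus> hdf)) =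
    (hev \<oplus> ehf \<otimes> ev) \<otimes> df \<oplus> (dev \<oplus> edf \<otimes> ev) \<otimes> \<ominus> hf"
proof -
  have cancel: "(c \<ominus> (x \<oplus> y) \<ominus> z \<ominus> (d \<ominus> (x' \<oplus> y') \<ominus> z')) \<ominus> (c \<ominus> d \<ominus> (y \<ominus> y')) =
      (x' \<ominus> z) \<oplus> \<ominus> (x \<ominus> z')"
    if "c \<in> carrier R" "d \<in> carrier R" "x \<in> carrier R" "y \<in> carrier R" "z \<in> carrier R"
      "x' \<in> carrier R" "y' \<in> carrier R" "z' \<in> carrier R" for c d x y z x' y' z'
    using that by algebra
  have collect: "(t \<oplus> y) \<otimes> h \<ominus> (y \<ominus> x \<otimes> z) \<otimes> h = (t \<oplus> z \<otimes> x) \<otimes> h"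
    if "t \<in> carrier R" "y \<in> carrier R" "x \<in> carrier R" "z \<in> carrier R" "h \<in> carrier R" for t x y z h
    using that by algebra
  have "ev \<otimes> (dhf \<ominus> hdf) = ev \<otimes> dhf \<ominus> ev \<otimes> hdf"
    using cl by (simp add: minus_eq r_distr r_minus)
  then show ?thesis
    using cl by (simp add: cancel collect r_minus)
qed

text \<open>
  The key formula: the curvature is presented as an element of \<open>Q\<^sup>* \<otimes> Q\<close>, \<open>Q\<close> the quotient, with two summands,
  \<open>curv_form \<eta> \<otimes> \<delta>(f) - curv_form \<delta> \<otimes> \<eta>(f)\<close>, so its trace can be read off.
\<close>

lemma curv_cls:
  assumes \<iota>: "\<And>c. \<iota> c \<in> carrier R"
    and \<delta>: "\<delta> \<in> derivations \<iota> R" and \<eta>: "\<eta> \<in> derivations \<iota> R"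
    and v: "\<And>i. v i \<in> carrier R"
  shows "curv \<delta> \<eta> (E.cls v) =
    E.cls (\<lambda>i. \<langle>curv_form \<eta>,v\<rangle> \<otimes> \<delta> (f i) \<oplus> \<langle>curv_form \<delta>,v\<rangle> \<otimes> \<ominus> \<eta> (f i))"
proof -
  interpret D: derivation R \<iota> \<delta> by unfold_locales fact
  interpret G: derivation R \<iota> \<eta> by unfold_locales fact
  have br: "der_bracket R \<delta> \<eta> \<in> derivations \<iota> R"
    using \<iota> \<delta> \<eta> by (rule der_bracket_derivation)
  have cl: "\<And>i. reduced \<delta> v i \<in> carrier R" "\<And>i. reduced \<eta> v i \<in> carrier R"
    "\<And>i. reduced \<delta> (reduced \<eta> v) i \<in> carrier R" "\<And>i. reduced \<eta> (reduced \<delta> v) i \<in> carrier R"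
    "\<And>i. reduced (der_bracket R \<delta> \<eta>) v i \<in> carrier R"
    by (intro reduced_closed[OF \<delta>] reduced_closed[OF \<eta>] reduced_closed[OF br] v)+
  then have in_F: "reduced \<delta> (reduced \<eta> v) \<in> carrier (free_module R)"
    "reduced \<eta> (reduced \<delta> v) \<in> carrier (free_module R)"
    "reduced (der_bracket R \<delta> \<eta>) v \<in> carrier (free_module R)"
    by (simp_all add: free_module_simps)
  define W where "W = (reduced \<delta> (reduced \<eta> v) \<ominus>\<^bsub>free_module R\<^esub> reduced \<eta> (reduced \<delta> v))
    \<ominus>\<^bsub>free_module R\<^esub> reduced (der_bracket R \<delta> \<eta>) v"
  have "W i = \<langle>curv_form \<eta>,v\<rangle> \<otimes> \<delta> (f i) \<oplus> \<langle>curv_form \<delta>,v\<rangle> \<otimes> \<ominus> \<eta> (f i)" for i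
  proof -
    have "W i = (reduced \<delta> (reduced \<eta> v) i \<ominus> reduced \<eta> (reduced \<delta> v) i)
        \<ominus> reduced (der_bracket R \<delta> \<eta>) v i"
      unfolding W_def using cl by (simp add: free_module_minus free_module_simps)
    note W_i = this
    have atoms: "\<delta> (\<eta> (v i)) \<in> carrier R" "\<eta> (\<delta> (v i)) \<in> carrier R" "\<delta> (f i) \<in> carrier R"
      "\<eta> (f i) \<in> carrier R" "\<delta> (\<eta> (f i)) \<in> carrier R" "\<eta> (\<delta> (f i)) \<in> carrier R"
      "\<langle>e,v\<rangle> \<in> carrier R" "\<langle>e,\<lambda>i. \<delta> (v i)\<rangle> \<in> carrier R" "\<langle>e,\<lambda>i. \<eta> (v i)\<rangle> \<in> carrier R"
      "\<langle>e,\<lambda>i. \<delta> (f i)\<rangle> \<in> carrier R" "\<langle>e,\<lambda>i. \<eta> (f i)\<rangle> \<in> carrier R"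
      "\<langle>\<lambda>i. \<delta> (e i),v\<rangle> \<in> carrier R" "\<langle>\<lambda>i. \<eta> (e i),v\<rangle> \<in> carrier R"
      by (intro pairing_closed D.der_closed G.der_closed f_closed e_closed v)+
    have br_i: "reduced (der_bracket R \<delta> \<eta>) v i =
        \<delta> (\<eta> (v i)) \<ominus> \<eta> (\<delta> (v i)) \<ominus> \<langle>e,v\<rangle> \<otimes> (\<delta> (\<eta> (f i)) \<ominus> \<eta> (\<delta> (f i)))"
      by (simp only: reduced_def der_bracket_def)
    show ?thesis
      unfolding W_i reduced_reduced[OF \<delta> \<eta> v] reduced_reduced[OF \<eta> \<delta> v] pairing_curv_form[OF \<delta> v]
        pairing_curv_form[OF \<eta> v] br_i
      by (rule curv_cancellation[OF atoms])
  qed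
  then have W: "W = (\<lambda>i. \<langle>curv_form \<eta>,v\<rangle> \<otimes> \<delta> (f i) \<oplus> \<langle>curv_form \<delta>,v\<rangle> \<otimes> \<ominus> \<eta> (f i))" by blast
  have "curv \<delta> \<eta> (E.cls v) = (E.cls (reduced \<delta> (reduced \<eta> v)) \<ominus>\<^bsub>E.Q\<^esub> E.cls (reduced \<eta> (reduced \<delta> v)))
      \<ominus>\<^bsub>E.Q\<^esub> E.cls (reduced (der_bracket R \<delta> \<eta>) v)"
    unfolding curv_def conn_cls[OF \<delta> v] conn_cls[OF \<eta> v] conn_cls[OF br v]
      conn_cls[OF \<delta> cl(2)] conn_cls[OF \<eta> cl(1)] ..
  also have "\<dots> = E.cls W"
    unfolding W_def by (simp only: E.cls_minus E.M.minus_closed in_F)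
  finally show ?thesis unfolding W .
qed

lemma proj_closed: "proj k j \<in> carrier R"
  by (simp add: proj_def)

lemma pairing_proj:
  assumes v: "\<And>i. v i \<in> carrier R"
  shows "\<langle>proj k,v\<rangle> = v k \<ominus> f k \<otimes> \<langle>e,v\<rangle>"
proof -
  have "\<langle>proj k,v\<rangle> = \<langle>v,\<lambda>j. (if k = j then \<one> else \<zero>) \<ominus> f k \<otimes> e j\<rangle>"
    unfolding proj_def using v by (intro pairing_comm) auto
  also have "\<dots> = \<langle>v,\<lambda>j. if k = j then \<one> else \<zero>\<rangle> \<ominus> f k \<otimes> \<langle>v,e\<rangle>"
    using v by (subst pairing_minus_right) (auto simp: pairing_smult_right)
  also have "\<dots> = v k \<ominus> f k \<otimes> \<langle>e,v\<rangle>"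
    using v by (simp add: pairing_comm[of v] pairing_unit)
  finally show ?thesis .
qed

lemma pairing_proj_f: "\<langle>proj k,f\<rangle> = \<zero>"
  by (simp add: pairing_proj pairing_e_f r_neg minus_eq)

text \<open>
  The rows of the projection, with the classes of the unit vectors, form a dual basis of the quotient:
  \<open>v\<close> and \<open>proj v = v - \<langle>e,v\<rangle> f\<close> have the same class.
\<close>

lemma cls_dual_basis:
  assumes "C \<in> carrier E.Q"
  shows "C = (\<Oplus>\<^bsub>E.Q\<^esub>k\<in>UNIV. form (proj k) C \<odot>\<^bsub>E.Q\<^esub> E.cls (\<lambda>i. if i = k then \<one> else \<zero>))"
proof -
  obtain v where v: "v \<in> carrier (free_module R)" "C = E.cls v" using assms by (rule E.cls_cases)
  have vc: "\<And>i. v i \<in> carrier R" using v(1) by (simp add: free_module_simps)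
  define b where "b k = form (proj k) C" for k
  have b: "b k = v k \<ominus> f k \<otimes> \<langle>e,v\<rangle>" for k
    unfolding b_def v(2) by (simp only: form_cls[OF proj_closed pairing_proj_f vc] pairing_proj[OF vc])
  have bc: "b k \<in> carrier R" for k
    unfolding b using vc by (simp add: pairing_closed)
  define u :: "'i \<Rightarrow> 'i \<Rightarrow> 'a" where "u k = (\<lambda>i. if i = k then \<one> else \<zero>)" for k
  have u: "u k \<in> carrier (free_module R)" for k by (simp add: u_def free_module_simps)
  have bu: "b k \<odot>\<^bsub>free_module R\<^esub> u k \<in> carrier (free_module R)" for k
    using bc u by simp
  have "(\<Oplus>\<^bsub>E.Q\<^esub>k\<in>UNIV. b k \<odot>\<^bsub>E.Q\<^esub> E.cls (u k)) =
      (\<Oplus>\<^bsub>E.Q\<^esub>k\<in>UNIV. E.cls (b k \<odot>\<^bsub>free_module R\<^esub> u k))"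
    by (simp only: E.cls_smult[OF bc u])
  also have "\<dots> = E.cls (\<Oplus>\<^bsub>free_module R\<^esub>k\<in>UNIV. b k \<odot>\<^bsub>free_module R\<^esub> u k)"
    using bu by (intro E.cls_finsum) auto
  also have "(\<Oplus>\<^bsub>free_module R\<^esub>k\<in>UNIV. b k \<odot>\<^bsub>free_module R\<^esub> u k) = b"
  proof
    fix i
    have "(\<Oplus>\<^bsub>free_module R\<^esub>k\<in>UNIV. b k \<odot>\<^bsub>free_module R\<^esub> u k) i =
        (\<Oplus>k\<in>UNIV. (b k \<odot>\<^bsub>free_module R\<^esub> u k) i)"
      using bu by (intro free_module_finsum) auto
    also have "\<dots> = (\<Oplus>k\<in>UNIV. if i = k then b k else \<zero>)"
      using bc by (intro finsum_cong') (auto simp: free_module_simps u_def)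
    also have "\<dots> = b i"
      using bc by (intro finsum_singleton) auto
    finally show "(\<Oplus>\<^bsub>free_module R\<^esub>k\<in>UNIV. b k \<odot>\<^bsub>free_module R\<^esub> u k) i = b i" .
  qed
  also have "E.cls b = C"
    unfolding v(2)
  proof (rule sym, rule cls_eqI[where a = "\<langle>e,v\<rangle>"])
    show "v i = b i \<oplus> \<langle>e,v\<rangle> \<otimes> f i" for i
    proof -
      have cancel: "x = (x \<ominus> y \<otimes> z) \<oplus> z \<otimes> y"
        if "x \<in> carrier R" "y \<in> carrier R" "z \<in> carrier R" for x y z
        using that by algebra
      show ?thesis
        unfolding b by (rule cancel[OF vc f_closed pairing_closed[OF e_closed vc]])
    qed
  qed (use vc bc pairing_closed[OF e_closed vc] in auto)
  finally show ?thesis unfolding b_def u_def by simp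
qed

text \<open>
  Evaluating the two summands of \<open>curv_cls\<close> gives this difference together with
  \<open>\<plusminus> \<langle>e,\<delta>(f)\<rangle> \<langle>e,\<eta>(f)\<rangle>\<close>, which cancels. The result measures the failure of the pairing of
  \<open>\<delta>(e)\<close> with \<open>\<eta>(f)\<close> to be symmetric in the two derivations.
\<close>

theorem module_trace_curv:
  assumes \<iota>: "\<And>c. \<iota> c \<in> carrier R"
    and \<delta>: "\<delta> \<in> derivations \<iota> R" and \<eta>: "\<eta> \<in> derivations \<iota> R"
  shows "module_trace R E.Q (curv \<delta> \<eta>) =
    \<langle>\<lambda>i. \<eta> (e i),\<lambda>i. \<delta> (f i)\<rangle> \<ominus> \<langle>\<lambda>i. \<delta> (e i),\<lambda>i. \<eta> (f i)\<rangle>"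
proof -
  interpret D: derivation R \<iota> \<delta> by unfold_locales fact
  interpret G: derivation R \<iota> \<eta> by unfold_locales fact
  (* The two summands of curv_cls as an element of the tensor product; the sign goes into the vector. *)
  define g where "g k = (if k = 0 then form (curv_form \<eta>) else form (curv_form \<delta>))" for k :: nat
  define w where "w k = (if k = 0 then E.cls (\<lambda>i. \<delta> (f i)) else E.cls (\<lambda>i. \<ominus> \<eta> (f i)))" for k :: nat
  have df: "(\<lambda>i. \<delta> (f i)) \<in> carrier (free_module R)"
    and hf: "(\<lambda>i. \<ominus> \<eta> (f i)) \<in> carrier (free_module R)"
    by (simp_all add: free_module_simps)
  have g: "g k \<in> dual_module R E.Q" for k
    unfolding g_def using form_dual[OF curv_form_closed[OF \<delta>] pairing_curv_form_f[OF \<delta>]]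
      form_dual[OF curv_form_closed[OF \<eta>] pairing_curv_form_f[OF \<eta>]] by simp
  have w: "w k \<in> carrier E.Q" for k
    unfolding w_def using E.cls_closed[OF df] E.cls_closed[OF hf] by simp
  have two: "{..<2::nat} = {0, 1}" by auto
  have curv: "curv \<delta> \<eta> m = (\<Oplus>\<^bsub>E.Q\<^esub>k\<in>{..<2}. g k m \<odot>\<^bsub>E.Q\<^esub> w k)" if m: "m \<in> carrier E.Q" for m
  proof -
    obtain v where v: "v \<in> carrier (free_module R)" "m = E.cls v" using m by (rule E.cls_cases)
    have vc: "\<And>i. v i \<in> carrier R" using v(1) by (simp add: free_module_simps)
    define s t where "s = \<langle>curv_form \<eta>,v\<rangle>" and "t = \<langle>curv_form \<delta>,v\<rangle>"
    have st: "s \<in> carrier R" "t \<in> carrier R"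
      unfolding s_def t_def by (intro pairing_closed curv_form_closed[OF \<delta>] curv_form_closed[OF \<eta>] vc)+
    have gs: "g 0 m = s" "g 1 m = t"
      unfolding g_def v(2) s_def t_def
      using form_cls[OF curv_form_closed[OF \<delta>] pairing_curv_form_f[OF \<delta>] vc]
        form_cls[OF curv_form_closed[OF \<eta>] pairing_curv_form_f[OF \<eta>] vc] by simp_all
    have "(\<Oplus>\<^bsub>E.Q\<^esub>k\<in>{..<2}. g k m \<odot>\<^bsub>E.Q\<^esub> w k) = s \<odot>\<^bsub>E.Q\<^esub> w 0 \<oplus>\<^bsub>E.Q\<^esub> t \<odot>\<^bsub>E.Q\<^esub> w 1"
      unfolding two using w st gs by (simp add: E.Q.M.finsum_insert)
    also have "\<dots> = E.cls (s \<odot>\<^bsub>free_module R\<^esub> (\<lambda>i. \<delta> (f i)) \<oplus>\<^bsub>free_module R\<^esub> t \<odot>\<^bsub>free_module R\<^esub> (\<lambda>i. \<ominus> \<eta> (f i)))"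
      using st df hf by (simp add: w_def E.cls_smult E.cls_add)
    also have "s \<odot>\<^bsub>free_module R\<^esub> (\<lambda>i. \<delta> (f i)) \<oplus>\<^bsub>free_module R\<^esub> t \<odot>\<^bsub>free_module R\<^esub> (\<lambda>i. \<ominus> \<eta> (f i)) =
        (\<lambda>i. s \<otimes> \<delta> (f i) \<oplus> t \<otimes> \<ominus> \<eta> (f i))"
      by (simp add: free_module_def)
    also have "E.cls (\<lambda>i. s \<otimes> \<delta> (f i) \<oplus> t \<otimes> \<ominus> \<eta> (f i)) = curv \<delta> \<eta> m"
      unfolding s_def t_def v(2) by (rule curv_cls[OF \<iota> \<delta> \<eta> vc, symmetric])
    finally show ?thesis by simp
  qed
  define a where "a = \<langle>curv_form \<eta>,\<lambda>i. \<delta> (f i)\<rangle> \<oplus> \<langle>curv_form \<delta>,\<lambda>i. \<ominus> \<eta> (f i)\<rangle>"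
  have gw: "g 0 (w 0) = \<langle>curv_form \<eta>,\<lambda>i. \<delta> (f i)\<rangle>" "g 1 (w 1) = \<langle>curv_form \<delta>,\<lambda>i. \<ominus> \<eta> (f i)\<rangle>"
    unfolding g_def w_def
    by (simp_all add: form_cls curv_form_closed[OF \<delta>] pairing_curv_form_f[OF \<delta>]
        curv_form_closed[OF \<eta>] pairing_curv_form_f[OF \<eta>])
  have cl: "g 0 (w 0) \<in> carrier R" "g 1 (w 1) \<in> carrier R"
    unfolding gw by (auto intro!: pairing_closed curv_form_closed[OF \<delta>] curv_form_closed[OF \<eta>])
  have "a = (\<Oplus>k\<in>{..<2}. g k (w k))"
    unfolding two a_def gw[symmetric] using cl by (simp add: finsum_insert)
  then have "a \<in> trace_values R E.Q (curv \<delta> \<eta>)"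
    unfolding trace_values_def using g w curv by blast
  then have "module_trace R E.Q (curv \<delta> \<eta>) = a"
  proof (rule E.Q.module_trace_eqI[rotated -1])
    show "C = (\<Oplus>\<^bsub>E.Q\<^esub>k\<in>UNIV. form (proj k) C \<odot>\<^bsub>E.Q\<^esub> E.cls (\<lambda>i. if i = k then \<one> else \<zero>))"
      if "C \<in> carrier E.Q" for C
      using that by (rule cls_dual_basis)
    show "form (proj k) \<in> dual_module R E.Q" for k
      by (rule form_dual[OF proj_closed pairing_proj_f])
    show "E.cls (\<lambda>i. if i = k then \<one> else \<zero>) \<in> carrier E.Q" for k
      by (rule E.cls_closed) (simp add: free_module_simps)
  qed simp
  moreover have "a = \<langle>\<lambda>i. \<eta> (e i),\<lambda>i. \<delta> (f i)\<rangle> \<ominus> \<langle>\<lambda>i. \<delta> (e i),\<lambda>i. \<eta> (f i)\<rangle>"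
  proof -
    have "a = (\<langle>\<lambda>i. \<eta> (e i),\<lambda>i. \<delta> (f i)\<rangle> \<oplus> \<langle>e,\<lambda>i. \<eta> (f i)\<rangle> \<otimes> \<langle>e,\<lambda>i. \<delta> (f i)\<rangle>) \<oplus>
        \<ominus> (\<langle>\<lambda>i. \<delta> (e i),\<lambda>i. \<eta> (f i)\<rangle> \<oplus> \<langle>e,\<lambda>i. \<delta> (f i)\<rangle> \<otimes> \<langle>e,\<lambda>i. \<eta> (f i)\<rangle>)"
      unfolding a_def by (simp add: pairing_uminus_right curv_form_closed[OF \<delta>] pairing_curv_form[OF \<delta>]
          pairing_curv_form[OF \<eta>])
    moreover have "(x \<oplus> s \<otimes> t) \<oplus> \<ominus> (y \<oplus> t \<otimes> s) = x \<ominus> y"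
      if "x \<in> carrier R" "y \<in> carrier R" "s \<in> carrier R" "t \<in> carrier R" for x y s t
      using that by algebra
    ultimately show ?thesis by simp
  qed
  ultimately show ?thesis by simp
qed

end

section \<open>The hypersurface\<close>

lemma UNIV_coord: "(UNIV :: coord set) = {Cx, Cy, Cz}"
  using coord.exhaust by auto

instance coord :: finite
  by standard (simp add: UNIV_coord)

text \<open>
  All that matters of \<open>\<delta>(a\<^sup>n) = n a\<^sup>n\<^sup>-\<^sup>1 \<delta>(a)\<close> is that one factor \<open>g\<close> serves all derivations.
\<close>

lemma (in cring) der_nat_pow_factor:
  assumes a: "a \<in> carrier R"
  shows "\<exists>g\<in>carrier R. \<forall>\<delta>\<in>derivations \<iota> R. \<delta> (a [^] (n::nat)) = g \<otimes> \<delta> a"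
proof (induction n)
  case 0
  have "\<delta> (a [^] (0::nat)) = \<zero> \<otimes> \<delta> a" if "\<delta> \<in> derivations \<iota> R" for \<delta>
  proof -
    interpret D: derivation R \<iota> \<delta> by unfold_locales fact
    show ?thesis using a by (simp add: D.der_one)
  qed
  then show ?case by blast
next
  case (Suc n)
  then obtain g where g: "g \<in> carrier R"
    "\<And>\<delta>. \<delta> \<in> derivations \<iota> R \<Longrightarrow> \<delta> (a [^] n) = g \<otimes> \<delta> a" by blast
  have "\<delta> (a [^] Suc n) = (g \<otimes> a \<oplus> a [^] n) \<otimes> \<delta> a" if "\<delta> \<in> derivations \<iota> R" for \<delta>
  proof -
    interpret D: derivation R \<iota> \<delta> by unfold_locales fact
    show ?thesis using a g(1) g(2)[OF that] by (simp add: D.der_mult l_distr r_distr m_ac a_comm)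
  qed
  moreover have "g \<otimes> a \<oplus> a [^] n \<in> carrier R" using g(1) a by simp
  ultimately show ?case by blast
qed

lemma Const_mult: "Const a * Const b = Const (a * b)"
  by (simp add: Const_def mult_single)

lemma Const_one: "Const 1 = 1"
  by (simp add: Const_def)

lemma of_nat_eq_Const: "of_nat n = Const (of_nat n)"
  by (simp add: Const_def)

definition expo :: "nat \<Rightarrow> nat \<Rightarrow> nat \<Rightarrow> coord \<Rightarrow> nat"
  where "expo p q r i = (case i of Cx \<Rightarrow> p | Cy \<Rightarrow> q | Cz \<Rightarrow> r)"

text \<open>The coefficients \<open>(x/p, y/q, z/r)\<close> of the Euler vector field for which \<open>x\<^sup>p + y\<^sup>q + z\<^sup>r\<close> has weight one.\<close>

definition euler_poly :: "nat \<Rightarrow> nat \<Rightarrow> nat \<Rightarrow> coord \<Rightarrow> 'k::field_char_0 poly3"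
  where "euler_poly p q r i = Const (1 / of_nat (expo p q r i)) * Var i"

lemma dF_poly_eq:
  "dF_poly p q r i = Const (of_nat (expo p q r i)) * Var i ^ (expo p q r i - 1)"
  by (cases i) (simp_all add: expo_def of_nat_eq_Const)

lemma dF_mult_euler:
  fixes i j :: coord
  shows "dF_poly p q r i * euler_poly p q r j =
    (Const (of_nat (expo p q r i) / of_nat (expo p q r j)) * Var i ^ (expo p q r i - 1) * Var j
      :: 'k::field_char_0 poly3)"
proof -
  have regroup: "a * b * (c * d) = (a * c) * b * d" for a b c d :: "'k poly3"
    by (simp only: ac_simps)
  show ?thesis
    unfolding dF_poly_eq euler_poly_def regroup Const_mult by simp
qed

lemma dF_mult_euler_same:
  assumes "p > 0" "q > 0" "r > 0"
  shows "dF_poly p q r i * euler_poly p q r i = (Var i ^ expo p q r i :: 'k::field_char_0 poly3)"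
proof -
  have pos: "expo p q r i > 0" using assms by (cases i) (simp_all add: expo_def)
  then have "Var i ^ (expo p q r i - 1) * Var i = (Var i ^ expo p q r i :: 'k poly3)"
    by (metis power_minus_mult)
  then show ?thesis
    using pos by (simp add: dF_mult_euler Const_one mult.assoc)
qed

text \<open>
  The identity \<open>M = 1 - dF e\<close> holds already for polynomials, before \<open>F = 0\<close> is imposed; on the
  diagonal, \<open>p x\<^sup>p\<^sup>-\<^sup>1 (x/p) = x\<^sup>p\<close> because \<open>p\<close> is positive and invertible in \<open>k\<close>.
\<close>

lemma M_poly_eq:
  assumes "p > 0" "q > 0" "r > 0"
  shows "M_poly p q r i j = (if i = j then 1 else 0)
    - (dF_poly p q r i * euler_poly p q r j :: 'k::field_char_0 poly3)"
proof (cases "i = j")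
  case True
  have "M_poly p q r i i = (1 - Var i ^ expo p q r i :: 'k poly3)"
    by (cases i) (simp_all add: expo_def)
  then show ?thesis using True by (simp add: dF_mult_euler_same[OF assms])
next
  case False
  then have "M_poly p q r i j =
      - (Const (of_nat (expo p q r i) / of_nat (expo p q r j)) * Var i ^ (expo p q r i - 1) * Var j
        :: 'k poly3)"
    by (cases i; cases j) (simp_all add: expo_def ac_simps)
  then show ?thesis using False by (simp add: dF_mult_euler)
qed

lemma poly3_ring_simps:
  "carrier poly3_ring = UNIV" "f \<oplus>\<^bsub>poly3_ring\<^esub> g = f + g" "f \<otimes>\<^bsub>poly3_ring\<^esub> g = f * g"
  "\<one>\<^bsub>poly3_ring\<^esub> = 1" "\<zero>\<^bsub>poly3_ring\<^esub> = 0"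
  by (simp_all add: ring_of_type_algebra_def)

lemma F_ideal_ideal: "ideal (F_ideal p q r) (poly3_ring :: 'k::comm_ring_1 poly3 ring)"
proof -
  interpret P: cring "poly3_ring :: 'k poly3 ring" by (rule cring_from_type_algebra)
  show ?thesis unfolding F_ideal_def by (rule P.genideal_ideal) (simp add: poly3_ring_simps)
qed

lemma cring_A_ring: "cring (A_ring p q r :: 'k::comm_ring_1 poly3 set ring)"
  unfolding A_ring_def by (rule ideal.quotient_is_cring[OF F_ideal_ideal cring_from_type_algebra])

lemma residue_hom: "residue p q r \<in> ring_hom poly3_ring (A_ring p q r)"
  unfolding A_ring_def residue_def[abs_def] by (rule ideal.rcos_ring_hom[OF F_ideal_ideal])

context
  fixes p q r :: nat and A :: "'k::comm_ring_1 poly3 set ring" (structure) and res :: "'k poly3 \<Rightarrow> 'k poly3 set"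
  defines "A \<equiv> A_ring p q r" and "res \<equiv> residue p q r"
begin

interpretation A: cring A unfolding A_def by (rule cring_A_ring)

lemma residue_closed [simp, intro]: "res f \<in> carrier A"
  and residue_add: "res (f + g) = res f \<oplus> res g"
  and residue_mult: "res (f * g) = res f \<otimes> res g"
  and residue_one: "res 1 = \<one>"
  unfolding A_def res_def by (simp_all add: ring_hom_memE[OF residue_hom, unfolded poly3_ring_simps])

lemma residue_zero: "res 0 = \<zero>"
  using residue_add[of 0 0] by simp

lemma residue_minus: "res (f - g) = res f \<ominus> res g"
proof -
  have "res f = res (f - g) \<oplus> res g"
    using residue_add[of "f - g" g] by simp
  then show ?thesis by (simp add: A.minus_eq A.a_assoc A.r_neg)
qed

lemma residue_power: "res (f ^ n) = res f [^] n"
  by (induction n) (simp_all add: residue_one residue_mult A.m_comm)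

end

lemma residue_F: "residue p q r (F_poly p q r :: 'k::comm_ring_1 poly3) = \<zero>\<^bsub>A_ring p q r\<^esub>"
proof -
  interpret P: cring "poly3_ring :: 'k poly3 ring" by (rule cring_from_type_algebra)
  interpret I: ideal "F_ideal p q r" "poly3_ring :: 'k poly3 ring" by (rule F_ideal_ideal)
  have "(F_poly p q r :: 'k poly3) \<in> F_ideal p q r"
    unfolding F_ideal_def using P.genideal_self'[of "F_poly p q r"] by (simp add: poly3_ring_simps)
  then show ?thesis
    unfolding residue_def A_ring_def FactRing_def by (simp add: I.a_rcos_const)
qed

definition euler :: "nat \<Rightarrow> nat \<Rightarrow> nat \<Rightarrow> coord \<Rightarrow> 'k::field_char_0 poly3 set"
  where "euler p q r i = residue p q r (euler_poly p q r i)"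

text \<open>The Euler relation gives \<open>\<langle>e,dF\<rangle> = x\<^sup>p + y\<^sup>q + z\<^sup>r = F + 1\<close>, and \<open>F\<close> vanishes in \<open>A\<close>.\<close>

lemma unimodular_dF:
  assumes "p > 0" "q > 0" "r > 0"
  shows "unimodular_vector (A_ring p q r :: 'k::field_char_0 poly3 set ring) (dF p q r) (euler p q r)"
proof -
  interpret A: cring "A_ring p q r :: 'k poly3 set ring" by (rule cring_A_ring)
  have "pairing (A_ring p q r) (euler p q r) (dF p q r) =
      (\<Oplus>\<^bsub>A_ring p q r\<^esub>i\<in>UNIV. residue p q r (Var i ^ expo p q r i :: 'k poly3))"
    unfolding pairing_def euler_def dF_def
    by (simp only: residue_mult[symmetric] mult.commute[of "euler_poly _ _ _ _"] dF_mult_euler_same[OF assms])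
  also have "\<dots> = residue p q r (Var Cx ^ p + (Var Cy ^ q + Var Cz ^ r))"
    unfolding UNIV_coord by (simp add: A.finsum_insert residue_add expo_def)
  also have "Var Cx ^ p + (Var Cy ^ q + Var Cz ^ r) = F_poly p q r + (1 :: 'k poly3)"
    by (simp add: F_poly_def)
  also have "residue p q r \<dots> = \<one>\<^bsub>A_ring p q r\<^esub>"
    by (simp only: residue_add residue_F residue_one) simp
  finally have pairing: "pairing (A_ring p q r) (euler p q r) (dF p q r) = \<one>\<^bsub>A_ring p q r :: 'k poly3 set ring\<^esub>" .
  show ?thesis
  proof unfold_locales
    show "dF p q r i \<in> carrier (A_ring p q r :: 'k poly3 set ring)" for i by (simp add: dF_def)
    show "euler p q r i \<in> carrier (A_ring p q r :: 'k poly3 set ring)" for i by (simp add: euler_def)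
  qed (rule pairing)
qed

text \<open>
  This symmetry is the reason for the vanishing trace. The \<open>i\<close>-th coordinates of \<open>e\<close> and of \<open>dF\<close> are
  both functions of the \<open>i\<close>-th variable \<open>x\<close> alone, so derivations \<open>\<delta>\<close> and \<open>\<eta>\<close> act on them by
  multiples of \<open>\<delta>(x)\<close> and \<open>\<eta>(x)\<close>, and both sides are the same multiple of \<open>\<delta>(x) \<eta>(x)\<close>.
\<close>

lemma der_euler_dF_symmetric:
  fixes \<delta> \<eta> :: "'k::field_char_0 poly3 set \<Rightarrow> 'k poly3 set"
  assumes \<delta>: "\<delta> \<in> Der_A p q r" and \<eta>: "\<eta> \<in> Der_A p q r"
  shows "\<eta> (euler p q r i) \<otimes>\<^bsub>A_ring p q r\<^esub> \<delta> (dF p q r i) =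
    \<delta> (euler p q r i) \<otimes>\<^bsub>A_ring p q r\<^esub> \<eta> (dF p q r i)"
proof -
  interpret A: cring "A_ring p q r :: 'k poly3 set ring" by (rule cring_A_ring)
  define x where "x = residue p q r (Var i :: 'k poly3)"
  define b where "b = residue p q r (Const (1 / of_nat (expo p q r i)) :: 'k poly3)"
  define c where "c = residue p q r (Const (of_nat (expo p q r i)) :: 'k poly3)"
  have cl: "x \<in> carrier (A_ring p q r)" "b \<in> carrier (A_ring p q r)" "c \<in> carrier (A_ring p q r)"
    by (simp_all add: x_def b_def c_def)
  have "\<exists>g\<in>carrier (A_ring p q r). \<forall>\<theta>\<in>Der_A p q r.
      \<theta> (x [^]\<^bsub>A_ring p q r\<^esub> (expo p q r i - 1)) = g \<otimes>\<^bsub>A_ring p q r\<^esub> \<theta> x"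
    unfolding Der_A_def by (rule A.der_nat_pow_factor[OF cl(1)])
  then obtain g where g: "g \<in> carrier (A_ring p q r)"
    and pow: "\<forall>\<theta>\<in>Der_A p q r.
      \<theta> (x [^]\<^bsub>A_ring p q r\<^esub> (expo p q r i - 1)) = g \<otimes>\<^bsub>A_ring p q r\<^esub> \<theta> x"
    by (rule bexE)
  have eu: "\<theta> (euler p q r i) = b \<otimes>\<^bsub>A_ring p q r\<^esub> \<theta> x"
    and df: "\<theta> (dF p q r i) = c \<otimes>\<^bsub>A_ring p q r\<^esub> (g \<otimes>\<^bsub>A_ring p q r\<^esub> \<theta> x)"
    and closed: "\<theta> x \<in> carrier (A_ring p q r)"
    if \<theta>: "\<theta> \<in> Der_A p q r" for \<theta>
  proof -
    interpret D: derivation "A_ring p q r :: 'k poly3 set ring" "\<lambda>c. residue p q r (Const c)" \<theta>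
      using \<theta> by unfold_locales (simp add: Der_A_def)
    have "euler p q r i = b \<otimes>\<^bsub>A_ring p q r\<^esub> x"
      by (simp add: euler_def euler_poly_def residue_mult b_def x_def)
    then show "\<theta> (euler p q r i) = b \<otimes>\<^bsub>A_ring p q r\<^esub> \<theta> x"
      using cl by (simp add: b_def D.der_scalar)
    have "dF p q r i = c \<otimes>\<^bsub>A_ring p q r\<^esub> x [^]\<^bsub>A_ring p q r\<^esub> (expo p q r i - 1)"
      unfolding dF_def dF_poly_eq residue_mult residue_power c_def x_def ..
    also have "\<theta> \<dots> = c \<otimes>\<^bsub>A_ring p q r\<^esub> \<theta> (x [^]\<^bsub>A_ring p q r\<^esub> (expo p q r i - 1))"
      unfolding c_def using cl(1) by (intro D.der_scalar A.nat_pow_closed)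
    finally show "\<theta> (dF p q r i) = c \<otimes>\<^bsub>A_ring p q r\<^esub> (g \<otimes>\<^bsub>A_ring p q r\<^esub> \<theta> x)"
      unfolding bspec[OF pow \<theta>] .
    show "\<theta> x \<in> carrier (A_ring p q r)" using cl(1) by (rule D.der_closed)
  qed
  show ?thesis
    unfolding eu[OF \<delta>] eu[OF \<eta>] df[OF \<delta>] df[OF \<eta>]
    using cl g closed[OF \<delta>] closed[OF \<eta>] by (simp add: A.m_ac)
qed

theorem corollary3p8:
  fixes p q r :: nat
    and \<delta> \<eta> :: "'k::field_char_0 poly3 set \<Rightarrow> 'k poly3 set"
  assumes "p \<ge> 2" and "q \<ge> 2" and "r \<ge> 2"
    and "\<delta> \<in> Der_A p q r" and "\<eta> \<in> Der_A p q r"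
  shows "module_trace (A_ring p q r) (Omega p q r) (curvature p q r \<delta> \<eta>) = \<zero>\<^bsub>A_ring p q r\<^esub>"
proof -
  have pos: "p > 0" "q > 0" "r > 0" using assms by auto
  interpret U: unimodular_vector "A_ring p q r :: 'k poly3 set ring" "dF p q r" "euler p q r"
    by (rule unimodular_dF[OF pos])
  have line: "A_dF p q r = U.f_line"
    by (simp add: A_dF_def U.f_line_def)
  have M: "M_mat p q r = U.proj"
  proof (intro ext)
    fix i j :: coord
    have "M_mat p q r i j = residue p q r (if i = j then 1 else 0 :: 'k poly3)
        \<ominus>\<^bsub>A_ring p q r\<^esub> dF p q r i \<otimes>\<^bsub>A_ring p q r\<^esub> euler p q r j"
      unfolding M_mat_def M_poly_eq[OF pos] residue_minus residue_mult dF_def euler_def ..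
    then show "M_mat p q r i j = U.proj i j"
      by (simp add: U.proj_def residue_one residue_zero)
  qed
  have nabla: "nabla p q r \<theta> = U.conn \<theta>" for \<theta>
    unfolding nabla_def U.conn_def line
    by (rule arg_cong[where f = "induced_on_quot _ _"]) (simp add: fun_eq_iff lifted_op_def U.conn_lift_def M)
  have Omega: "Omega p q r = U.E.Q"
    unfolding Omega_def line ..
  have "curvature p q r \<delta> \<eta> = U.curv \<delta> \<eta>"
    unfolding curvature_def U.curv_def nabla Omega ..
  then have "module_trace (A_ring p q r) (Omega p q r) (curvature p q r \<delta> \<eta>) =
      U.pair (\<lambda>i. \<eta> (euler p q r i)) (\<lambda>i. \<delta> (dF p q r i))
      \<ominus>\<^bsub>A_ring p q r\<^esub> U.pair (\<lambda>i. \<delta> (euler p q r i)) (\<lambda>i. \<eta> (dF p q r i))"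
    unfolding Omega using assms(4,5) unfolding Der_A_def
    by (simp only:) (rule U.module_trace_curv[where \<iota> = "\<lambda>c. residue p q r (Const c)"], auto)
  also have "U.pair (\<lambda>i. \<eta> (euler p q r i)) (\<lambda>i. \<delta> (dF p q r i)) =
      U.pair (\<lambda>i. \<delta> (euler p q r i)) (\<lambda>i. \<eta> (dF p q r i))"
    unfolding pairing_def by (simp only: der_euler_dF_symmetric[OF assms(4,5)])
  also have "\<dots> \<ominus>\<^bsub>A_ring p q r\<^esub> \<dots> = \<zero>\<^bsub>A_ring p q r\<^esub>"
  proof -
    have "U.pair (\<lambda>i. \<delta> (euler p q r i)) (\<lambda>i. \<eta> (dF p q r i)) \<in> carrier (A_ring p q r)"
      using assms(4,5) by (intro U.pairing_closed)
        (auto simp: Der_A_def derivations_def euler_def dF_def)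
    then show ?thesis by (simp add: U.minus_eq U.r_neg)
  qed
  finally show ?thesis .
qed

end
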